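(* Let $M$ be a segment $K_3$-free graph with $m=m(M)$ segments. Then \[p(M)\leq {m\choose 2}-(m-2),\qquad c(M)\leq {m-2\choose 2},\] and these bounds are tight.
   Context: $M$ is a finite set of line segments of nonzero length in the plane; collinear intersecting segments are treated as a single segment. $P(M)$ is the set of points lying on at least two segments of $M$, $J(M)$ the set of segment endpoints. $G_M$ is the graph with vertex set $P(M)\cup J(M)$, where $u,v$ are adjacent iff some segment $s\in M$ contains both and no point of $P(M)\cup J(M)$ lies on $s$ strictly between them, embedded as drawn by $M$. Circuits are the bounded faces of $G_M$; $p(M)=|P(M)|$ and $c(M)$ is the number of circuits. $M$ is a segment $K_3$-free graph if $G_M$ has no subgraph isomorphic to $K_3$. "Tight" means there exist segment $K_3$-free graphs (for infinitely many $m$) for which both bounds hold with equality. *)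

theory Defs
  imports "HOL-Analysis.Analysis"
begin

type_synonym point = "real ^ 2"

(* A segment is identified with the set of its points.  The convention that collinear
   intersecting segments count as one segment is the last conjunct: after merging, two
   distinct segments on a common line are disjoint. *)
definition segment_system :: "point set set \<Rightarrow> bool" where
  "segment_system M \<longleftrightarrow> finite M
     \<and> (\<forall>s\<in>M. \<exists>a b. a \<noteq> b \<and> s = closed_segment a b)
     \<and> (\<forall>s\<in>M. \<forall>t\<in>M. s \<noteq> t \<longrightarrow> collinear (s \<union> t) \<longrightarrow> s \<inter> t = {})"

definition crossing_points :: "point set set \<Rightarrow> point set" where
  "crossing_points M = {x. \<exists>s\<in>M. \<exists>t\<in>M. s \<noteq> t \<and> x \<in> s \<and> x \<in> t}"

definition segment_endpoints :: "point set set \<Rightarrow> point set" where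
  "segment_endpoints M = {a. \<exists>b. closed_segment a b \<in> M}"

definition seg_verts :: "point set set \<Rightarrow> point set" where
  "seg_verts M = crossing_points M \<union> segment_endpoints M"

definition seg_edges :: "point set set \<Rightarrow> point set set" where
  "seg_edges M = {{u, v} | u v. u \<in> seg_verts M \<and> v \<in> seg_verts M \<and> u \<noteq> v
     \<and> (\<exists>s\<in>M. u \<in> s \<and> v \<in> s \<and> \<not> (\<exists>x\<in>seg_verts M. x \<in> s \<and> x \<in> open_segment u v))}"

definition has_K3 :: "'a set \<Rightarrow> 'a set set \<Rightarrow> bool" where
  "has_K3 V E \<longleftrightarrow> (\<exists>T\<subseteq>V. card T = 3 \<and> (\<forall>u\<in>T. \<forall>v\<in>T. u \<noteq> v \<longrightarrow> {u, v} \<in> E))"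

definition segment_K3_free :: "point set set \<Rightarrow> bool" where
  "segment_K3_free M \<longleftrightarrow> segment_system M \<and> \<not> has_K3 (seg_verts M) (seg_edges M)"

(* The straight-line drawing: an edge e = {u, v} is drawn as its convex hull,
   i.e. as the closed segment from u to v. *)
definition seg_drawing :: "point set set \<Rightarrow> point set" where
  "seg_drawing M = seg_verts M \<union> (\<Union>e\<in>seg_edges M. convex hull e)"

definition circuits :: "point set set \<Rightarrow> point set set" where
  "circuits M = {F \<in> components (- seg_drawing M). bounded F}"

definition num_points :: "point set set \<Rightarrow> nat" where
  "num_points M = card (crossing_points M)"

definition num_circuits :: "point set set \<Rightarrow> nat" where
  "num_circuits M = card (circuits M)"

end

theory Submission
  imports Defs
begin

text \<open>
  Move the supporting line of every segment parallel to itself, with velocity \<open>w s\<close>. Ask that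
  concurrent segments stay concurrent, that disjoint parallel segments keep their distance, and
  that for two disjoint non-parallel segments one well-chosen triangle (cut off by a third segment)
  keeps its size. Each disjoint pair costs one linear equation and a crossing point of degree \<open>k\<close>
  costs at most \<open>(k - 1) choose 2\<close>. If there were fewer than \<open>m - 2\<close> equations, some motion other than
  a translation would satisfy them. Among all pairs of crossing points on a common segment take
  those with the largest relative speed; they span triangles of segments, and one of least area
  has unsubdivided sides, that is, it is a \<open>K\<^sub>3\<close>. Hence, for connected systems,
  \<open>(\<Sum>x. deg x - 1) \<le> (m choose 2) - (m - 2)\<close>. The left side bounds the number of crossing points, and
  by Euler's formula it exceeds the number of circuits by \<open>m - 1\<close>.

  Equality holds for segments on the lines \<open>y = t x + t\<^sup>3\<close> with \<open>t = (-1/2)\<^sup>k\<close>, \<open>k \<le> n\<close>, together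
  with \<open>t = 0\<close>: lines \<open>t\<close>, \<open>u\<close> meet above \<open>x = - (t\<^sup>2 + t u + u\<^sup>2)\<close>, and the segments are cut so that
  exactly the consecutive powers miss each other.
\<close>

section \<open>Components of the complement of a union of segments\<close>

text \<open>The 2 in m - 2 is the plane of translations: translating by \<open>c\<close> changes
  each \<open>h s\<close> at rate \<open>det2 (d s) c\<close> and satisfies every equation. The
  equations need not describe rigidity; they only have to forbid that crossing points on a segment
  separate at a positive rate, since the reversed motion then forbids approach. At the largest rate
  R > 0 the field \<open>v x - R *\<^sub>R x\<close> agrees at both points of an extremal pair and
  weakly contracts along every segment, so crossings between the two points share its value. This is
  what lets triangles shrink. The obstacle is an extremal triangle lacking a corner because two of
  its segments are disjoint. Their lines meet at a point z off at least one of them; freezing the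
  triangle nearest to z, measured along a segment that misses z, makes one equation per disjoint
  pair enough. The weight degree minus one serves twice: it counts the equations saved, and it is
  the quantity in Euler's formula. In the example the alternating sign makes consecutive slopes meet
  to the right of all other crossings on the steeper line, where a cut removes just these.\<close>

definition to_c :: "point \<Rightarrow> complex" where
  "to_c v = Complex (v$1) (v$2)"

lemma linear_to_c: "linear to_c"
  by (rule linearI) (auto simp: to_c_def complex_eq_iff)

lemma bij_to_c: "bij to_c"
proof (rule bijI)
  show "inj to_c" by (rule injI) (auto simp: to_c_def vec_eq_iff forall_2)
  show "surj to_c"
  proof (rule surjI)
    show "to_c (vector [Re z, Im z]) = z" for z by (simp add: to_c_def)
  qed
qed

lemma inj_to_c: "inj to_c" using bij_to_c bij_is_inj by blast

lemma continuous_on_to_c: "continuous_on A to_c"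
  using linear_to_c linear_continuous_on linear_linear by blast

lemma open_image_to_c: "open T \<Longrightarrow> open (to_c ` T)"
  using linear_to_c bij_to_c bij_is_surj open_surjective_linear_image by blast

lemma compact_image_to_c: "compact T \<Longrightarrow> compact (to_c ` T)"
  using continuous_on_to_c compact_continuous_image by blast

lemma Compl_image_to_c: "to_c ` (- T) = - to_c ` T"
  using bij_to_c by (rule bij_image_Compl_eq)

lemma connected_image_to_c_iff: "connected (to_c ` T) \<longleftrightarrow> connected T"
  using linear_to_c inj_to_c by (metis homeomorphic_connectedness linear_homeomorphic_image)

lemma connected_component_to_c_iff:
  "connected_component (to_c ` T) (to_c a) (to_c b) \<longleftrightarrow> connected_component T a b" (is "?L \<longleftrightarrow> ?R")
proof
  assume ?R
  then obtain C where "connected C" "C \<subseteq> T" "a \<in> C" "b \<in> C" by (auto simp: connected_component_def)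
  then show ?L unfolding connected_component_def
    by (intro exI[of _ "to_c ` C"]) (auto simp: connected_image_to_c_iff)
next
  assume ?L
  then obtain C where C: "connected C" "C \<subseteq> to_c ` T" "to_c a \<in> C" "to_c b \<in> C" by (auto simp: connected_component_def)
  have eq: "to_c ` (to_c -` C) = C" using bij_to_c by (metis bij_is_surj surj_image_vimage_eq)
  then have "connected (to_c -` C)" using C(1) connected_image_to_c_iff by metis
  moreover have "to_c -` C \<subseteq> T" using C(2) inj_to_c by (auto dest: injD)
  ultimately show ?R unfolding connected_component_def using C by (intro exI[of _ "to_c -` C"]) auto
qed

text \<open>Janiszewski's theorem is stated for \<open>complex\<close>; the linear homeomorphism
  \<open>to_c\<close> carries compactness, complements and connected components across.\<close>

lemma Janiszewski_point:
  fixes S T :: "point set"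
  assumes "compact S" "compact T" "connected (S \<inter> T)"
    "connected_component (- S) a b" "connected_component (- T) a b"
  shows "connected_component (- (S \<union> T)) a b"
proof -
  have "connected_component (- (to_c ` S \<union> to_c ` T)) (to_c a) (to_c b)"
  proof (rule Janiszewski)
    show "compact (to_c ` S)" "closed (to_c ` T)" using assms compact_image_to_c compact_imp_closed by blast+
    show "connected (to_c ` S \<inter> to_c ` T)"
      using assms(3) by (simp add: image_Int[OF inj_to_c, symmetric] connected_image_to_c_iff)
    show "connected_component (- to_c ` S) (to_c a) (to_c b)" "connected_component (- to_c ` T) (to_c a) (to_c b)"
      using assms(4,5) by (simp_all add: Compl_image_to_c[symmetric] connected_component_to_c_iff)
  qed
  then show ?thesis
    by (simp add: image_Un[symmetric] Compl_image_to_c[symmetric] connected_component_to_c_iff del: Compl_Un)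
qed

text \<open>Of inside and outside only this is kept: two disjoint open sides, both met by every open
  set that touches the curve. It suffices for finding points on both sides of an edge.\<close>

lemma Jordan_point:
  fixes c :: "real \<Rightarrow> point"
  assumes "simple_path c" "pathfinish c = pathstart c"
  obtains I Ou where "open I" "open Ou" "I \<inter> Ou = {}" "I \<union> Ou = - path_image c"
    "\<And>T. \<lbrakk>open T; T \<inter> path_image c \<noteq> {}\<rbrakk> \<Longrightarrow> T \<inter> I \<noteq> {} \<and> T \<inter> Ou \<noteq> {}"
proof -
  let ?c = "to_c \<circ> c"
  have sp: "simple_path ?c" using simple_path_linear_image_eq[OF linear_to_c inj_to_c] assms(1) by blast
  have pf: "pathfinish ?c = pathstart ?c" using assms(2) by (simp add: pathfinish_def pathstart_def)
  have im: "path_image ?c = to_c ` path_image c" by (simp add: path_image_compose)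
  have J: "open (inside (path_image ?c))" "open (outside (path_image ?c))"
    "frontier (inside (path_image ?c)) = path_image ?c" "frontier (outside (path_image ?c)) = path_image ?c"
    using Jordan_inside_outside[OF sp pf] by simp_all
  define I where "I = to_c -` inside (path_image ?c)"
  define Ou where "Ou = to_c -` outside (path_image ?c)"
  have op: "open (to_c -` X)" if "open X" for X
    using that by (intro open_vimage continuous_on_to_c)
  have "I \<union> Ou = - path_image c"
  proof -
    have "I \<union> Ou = to_c -` (- path_image ?c)"
      unfolding I_def Ou_def vimage_Un[symmetric] inside_Un_outside ..
    then show ?thesis using im inj_to_c by (auto dest: injD)
  qed
  moreover have "T \<inter> I \<noteq> {} \<and> T \<inter> Ou \<noteq> {}" if T: "open T" "T \<inter> path_image c \<noteq> {}" for T
  proof -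
    obtain p where p: "p \<in> T" "p \<in> path_image c" using T by blast
    have "to_c p \<in> path_image ?c" unfolding im using p by simp
    then have "to_c p \<in> frontier (inside (path_image ?c))" "to_c p \<in> frontier (outside (path_image ?c))"
      by (simp_all only: J)
    then have "to_c p \<in> closure (inside (path_image ?c))" "to_c p \<in> closure (outside (path_image ?c))"
      by (auto simp: frontier_def)
    moreover have "open (to_c ` T)" "to_c p \<in> to_c ` T" using T p open_image_to_c by auto
    ultimately have "to_c ` T \<inter> inside (path_image ?c) \<noteq> {}" "to_c ` T \<inter> outside (path_image ?c) \<noteq> {}"
      by (metis disjoint_iff open_Int_closure_eq_empty)+
    then show ?thesis by (auto simp: I_def Ou_def)
  qed
  moreover have "I \<inter> Ou = {}" unfolding I_def Ou_def vimage_Int[symmetric] by simp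
  moreover have "open I" "open Ou" unfolding I_def Ou_def using op J by blast+
  ultimately show ?thesis using that by blast
qed

section \<open>Components before and after adding a segment\<close>

definition enclosing_component :: "point set \<Rightarrow> point set \<Rightarrow> point set" where
  "enclosing_component K D = connected_component_set (- K) (SOME x. x \<in> D)"

text \<open>\<open>D\<close> is connected and avoids \<open>K\<close>, so it lies in a single
  component of \<open>- K\<close> and the choice of its representative is immaterial.\<close>

lemma enclosing_component:
  assumes "D \<in> components (- L)" "K \<subseteq> L" "x \<in> D"
  shows "enclosing_component K D = connected_component_set (- K) x" "enclosing_component K D \<in> components (- K)"
    "D \<subseteq> enclosing_component K D"
proof -
  let ?y = "SOME x. x \<in> D"
  have y: "?y \<in> D" using assms(3) by (rule someI)
  have D: "connected D" "D \<subseteq> - K" using assms in_components_connected in_components_subset by blast+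
  have sub: "D \<subseteq> connected_component_set (- K) z" if "z \<in> D" for z
    using D that by (intro connected_component_maximal) auto
  then show "enclosing_component K D = connected_component_set (- K) x"
    unfolding enclosing_component_def using y assms(3) connected_component_eq by blast
  show "enclosing_component K D \<in> components (- K)"
    unfolding enclosing_component_def using y D by (auto simp: components_def)
  show "D \<subseteq> enclosing_component K D" unfolding enclosing_component_def using sub y by blast
qed

text \<open>A segment has empty interior, so every component of \<open>- K\<close> keeps a point off
  it. Counting components thereby becomes a question about the injectivity of
  \<open>enclosing_component K\<close>.\<close>

lemma enclosing_component_surj:
  assumes "closed K"
  shows "enclosing_component K ` components (- (K \<union> closed_segment a b)) = components (- K)"
proof
  show "enclosing_component K ` components (- (K \<union> closed_segment a b)) \<subseteq> components (- K)"
  proof (rule image_subsetI)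
    fix D assume D: "D \<in> components (- (K \<union> closed_segment a b))"
    then obtain x where "x \<in> D" using in_components_nonempty by blast
    then show "enclosing_component K D \<in> components (- K)" using enclosing_component(2)[OF D] by blast
  qed
next
  show "components (- K) \<subseteq> enclosing_component K ` components (- (K \<union> closed_segment a b))"
  proof
    fix C assume C: "C \<in> components (- K)"
    then have "open C" "C \<noteq> {}" using assms open_components in_components_nonempty by blast+
    moreover have "interior (closed_segment a b) = {}" by (rule interior_closed_segment_ge2) simp
    ultimately have "\<not> C \<subseteq> closed_segment a b" using interior_maximal[of C "closed_segment a b"] by auto
    then obtain x where x: "x \<in> C" "x \<notin> closed_segment a b" by blast
    have "x \<notin> K" using C x in_components_subset by blast
    define D where "D = connected_component_set (- (K \<union> closed_segment a b)) x"
    have D: "D \<in> components (- (K \<union> closed_segment a b))" "x \<in> D"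
      using x \<open>x \<notin> K\<close> by (auto simp: D_def components_def)
    have "enclosing_component K D = connected_component_set (- K) x"
      using enclosing_component(1)[OF D(1) _ D(2)] by blast
    also have "\<dots> = C" using C x(1)
      by (metis components_iff connected_component_eq)
    finally show "C \<in> enclosing_component K ` components (- (K \<union> closed_segment a b))" using D by blast
  qed
qed

text \<open>Neither \<open>K\<close> nor the segment separates two points of one old component, so
  by Janiszewski's theorem their union does not either. The empty intersection is connected, hence
  segments disjoint from \<open>K\<close> are included.\<close>

lemma add_tail:
  fixes K :: "point set"
  assumes K: "compact K" and con: "connected (K \<inter> closed_segment a b)" and fin: "finite (components (- K))"
  shows "finite (components (- (K \<union> closed_segment a b))) \<and>
    card (components (- (K \<union> closed_segment a b))) = card (components (- K))"
proof -
  let ?e = "closed_segment a b"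
  have "inj_on (enclosing_component K) (components (- (K \<union> ?e)))"
  proof (rule inj_onI)
    fix D D' assume D: "D \<in> components (- (K \<union> ?e))" and D': "D' \<in> components (- (K \<union> ?e))"
      and eq: "enclosing_component K D = enclosing_component K D'"
    obtain x y where x: "x \<in> D" and y: "y \<in> D'" using D D' in_components_nonempty by blast
    have xy: "x \<notin> K \<union> ?e" "y \<notin> K \<union> ?e" using D D' x y in_components_subset by blast+
    have "connected_component_set (- K) x = connected_component_set (- K) y"
      using enclosing_component(1)[OF D _ x, of K] enclosing_component(1)[OF D' _ y, of K] eq by simp
    then have K_xy: "connected_component (- K) x y" using xy by (simp add: connected_component_eq_eq)
    have "connected (- ?e)" by (rule connected_complement_bounded_convex) (auto simp: compact_imp_bounded)
    then have "connected_component (- ?e) x y" using xy by (auto simp: connected_iff_connected_component)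
    then have "connected_component (- (K \<union> ?e)) x y" using Janiszewski_point[OF K _ con K_xy] by simp
    then have "y \<in> connected_component_set (- (K \<union> ?e)) x" by simp
    moreover have "connected_component_set (- (K \<union> ?e)) x = D" using D x
      by (metis components_iff connected_component_eq)
    ultimately show "D = D'" using components_nonoverlap[OF D D'] y by blast
  qed
  then show ?thesis using enclosing_component_surj[OF compact_imp_closed[OF K], of a b] fin
    by (metis card_image finite_imageD)
qed

section \<open>The two sides of an edge and the effect of adding it\<close>

definition perp :: "point \<Rightarrow> point" where "perp v = vector [- (v$2), v$1]"

lemma perp_simps [simp]: "perp v \<bullet> v = 0" "v \<bullet> perp v = 0" "norm (perp v) = norm v" "perp v \<bullet> perp v = v \<bullet> v"
  by (simp_all add: perp_def inner_vec_def sum_2 norm_vec_def L2_set_def)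

lemma perp_decompose:
  assumes "v \<noteq> 0"
  shows "z = (z \<bullet> v / (v \<bullet> v)) *\<^sub>R v + (z \<bullet> perp v / (v \<bullet> v)) *\<^sub>R perp v"
proof -
  have "(v \<bullet> v) *\<^sub>R z = (z \<bullet> v) *\<^sub>R v + (z \<bullet> perp v) *\<^sub>R perp v"
    by (simp add: vec_eq_iff forall_2 perp_def inner_vec_def sum_2 algebra_simps power2_eq_square)
  then have "(1 / (v \<bullet> v)) *\<^sub>R ((v \<bullet> v) *\<^sub>R z) = (1 / (v \<bullet> v)) *\<^sub>R ((z \<bullet> v) *\<^sub>R v + (z \<bullet> perp v) *\<^sub>R perp v)"
    by simp
  then show ?thesis using assms by (simp add: scaleR_add_right)
qed

text \<open>A tube around the open edge whose half-width at each point is the distance to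
  \<open>K\<close>: it cannot reach \<open>K\<close>, and the edge splits it into two connected
  halves.\<close>

lemma edge_neighbourhood:
  fixes K :: "point set"
  assumes K: "closed K" "K \<noteq> {}" and ab: "a \<noteq> b" and dis: "open_segment a b \<inter> K = {}"
  obtains T W1 W2 where "open T" "connected T" "T \<inter> K = {}" "open_segment a b \<subseteq> T"
    "connected W1" "connected W2" "T - closed_segment a b = W1 \<union> W2"
proof -
  define v where "v = b - a"
  have v0: "v \<noteq> 0" using ab by (simp add: v_def)
  \<comment> \<open>Dividing by \<open>norm v\<close> compensates for the length of
    \<open>perp v\<close>: the offset in \<open>F p\<close> then has length
    \<open>\<bar>snd p\<bar>\<close> times the distance to \<open>K\<close>.\<close>
  define g where "g s = infdist (a + s *\<^sub>R v) K / norm v" for s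
  define F where "F p = a + fst p *\<^sub>R v + (snd p * g (fst p)) *\<^sub>R perp v" for p :: "real \<times> real"
  define A where "A z = (z - a) \<bullet> v / (v \<bullet> v)" for z
  define B where "B z = (z - a) \<bullet> perp v / (v \<bullet> v)" for z
  have in_open: "a + s *\<^sub>R v \<in> open_segment a b" if "0 < s" "s < 1" for s
    using that ab by (auto simp: in_segment v_def algebra_simps intro!: exI[of _ s])
  have gpos: "g s > 0" if "0 < s" "s < 1" for s
  proof -
    have "a + s *\<^sub>R v \<notin> K" using in_open[OF that] dis by blast
    then show ?thesis using K v0 by (simp add: g_def infdist_pos_not_in_closed)
  qed
  have cg: "continuous_on UNIV g" unfolding g_def using v0 by (intro continuous_intros) auto
  have cF: "continuous_on X F" for X
    unfolding F_def by (intro continuous_intros continuous_on_compose2[OF cg]) auto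
  define T where "T = F ` ({0<..<1} \<times> {-1<..<1})"
  define W1 where "W1 = F ` ({0<..<1} \<times> {0<..<1})"
  define W2 where "W2 = F ` ({0<..<1} \<times> {-1<..<0})"
  have con: "connected T" "connected W1" "connected W2"
    unfolding T_def W1_def W2_def by (intro connected_continuous_image cF connected_Times; simp)+
  have AF: "A (F p) = fst p" and BF: "B (F p) = snd p * g (fst p)" for p
    using v0 by (simp_all add: A_def B_def F_def inner_add_left)
  \<comment> \<open>\<open>T\<close> is connected as the image of a rectangle; this second
    description, by strict inequalities between continuous functions, makes it open.\<close>
  have T_eq: "T = {z. 0 < A z \<and> A z < 1 \<and> \<bar>B z\<bar> < g (A z)}"
  proof (intro equalityI subsetI)
    fix z assume "z \<in> T"
    then obtain p where p: "z = F p" "0 < fst p" "fst p < 1" "-1 < snd p" "snd p < 1" by (auto simp: T_def)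
    have "\<bar>snd p\<bar> * g (fst p) < g (fst p)" using p gpos[of "fst p"] by simp
    then show "z \<in> {z. 0 < A z \<and> A z < 1 \<and> \<bar>B z\<bar> < g (A z)}"
      using p gpos[of "fst p"] by (simp add: AF BF abs_mult)
  next
    fix z assume "z \<in> {z. 0 < A z \<and> A z < 1 \<and> \<bar>B z\<bar> < g (A z)}"
    then have z: "0 < A z" "A z < 1" "\<bar>B z\<bar> < g (A z)" by auto
    have g0: "g (A z) > 0" using gpos z by blast
    have "z - a = A z *\<^sub>R v + B z *\<^sub>R perp v" using perp_decompose[OF v0, of "z - a"] by (simp add: A_def B_def)
    then have "z = F (A z, B z / g (A z))" using g0 by (simp add: F_def algebra_simps)
    moreover have "\<bar>B z / g (A z)\<bar> < 1" using z g0 by simp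
    then have "-1 < B z / g (A z)" "B z / g (A z) < 1" by linarith+
    ultimately show "z \<in> T" unfolding T_def using z by (intro image_eqI[of _ _ "(A z, B z / g (A z))"]) auto
  qed
  have cA: "continuous_on UNIV A" "continuous_on UNIV B" unfolding A_def B_def by (intro continuous_intros; use v0 in simp)+
  have cgA: "continuous_on UNIV (\<lambda>z. g (A z))" by (rule continuous_on_compose2[OF cg cA(1)]) simp
  have "open T" unfolding T_eq
    by (intro open_Collect_conj open_Collect_less continuous_intros cA cgA)
  moreover have "T \<inter> K = {}"
  proof -
    have False if p: "p \<in> {0<..<1} \<times> {-1<..<1}" "F p \<in> K" for p
    proof -
      have pp: "0 < fst p" "fst p < 1" "\<bar>snd p\<bar> < 1" using p by auto
      have "infdist (a + fst p *\<^sub>R v) K \<le> dist (a + fst p *\<^sub>R v) (F p)" using p(2) by (rule infdist_le)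
      also have "\<dots> = \<bar>snd p\<bar> * infdist (a + fst p *\<^sub>R v) K"
        using v0 by (simp add: F_def dist_norm g_def abs_mult infdist_nonneg)
      finally have "g (fst p) \<le> \<bar>snd p\<bar> * g (fst p)" using v0 by (simp add: g_def divide_right_mono)
      then show False using gpos[OF pp(1,2)] pp(3) by simp
    qed
    then show ?thesis by (auto simp: T_def)
  qed
  moreover have "open_segment a b \<subseteq> T"
  proof
    fix z assume "z \<in> open_segment a b"
    then obtain s where s: "0 < s" "s < 1" "z = (1 - s) *\<^sub>R a + s *\<^sub>R b" by (auto simp: in_segment)
    then have "z = F (s, 0)" by (simp add: F_def v_def algebra_simps)
    then show "z \<in> T" unfolding T_def using s by (intro image_eqI[of _ _ "(s, 0)"]) auto
  qed
  moreover have "T - closed_segment a b = W1 \<union> W2"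
  proof -
    have seg: "F p \<in> closed_segment a b \<longleftrightarrow> snd p = 0" if p: "0 < fst p" "fst p < 1" for p
    proof
      assume "F p \<in> closed_segment a b"
      then obtain s where "F p = (1 - s) *\<^sub>R a + s *\<^sub>R b" by (auto simp: in_segment)
      then have "F p - a = s *\<^sub>R v" by (simp add: v_def algebra_simps)
      then have "B (F p) = 0" by (simp add: B_def)
      then show "snd p = 0" using BF gpos[OF p] by simp
    next
      assume "snd p = 0"
      then have "F p = a + fst p *\<^sub>R v" by (simp add: F_def)
      then show "F p \<in> closed_segment a b" using in_open[OF p] segment_open_subset_closed by auto
    qed
    show ?thesis
    proof (intro equalityI subsetI)
      fix z assume "z \<in> T - closed_segment a b"
      then obtain p where p: "z = F p" "0 < fst p" "fst p < 1" "-1 < snd p" "snd p < 1" "snd p \<noteq> 0"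
        using seg by (auto simp: T_def)
      then have "p \<in> {0<..<1} \<times> {0<..<1} \<or> p \<in> {0<..<1} \<times> {-1<..<0}" by (cases p) auto
      then show "z \<in> W1 \<union> W2" using p(1) by (auto simp: W1_def W2_def)
    next
      fix z assume "z \<in> W1 \<union> W2"
      then obtain p where p: "z = F p" "0 < fst p" "fst p < 1" "-1 < snd p" "snd p < 1" "snd p \<noteq> 0"
        by (auto simp: W1_def W2_def)
      then have "p \<in> {0<..<1} \<times> {-1<..<1}" by (cases p) auto
      then show "z \<in> T - closed_segment a b" using p seg[OF p(2,3)] by (auto simp: T_def)
    qed
  qed
  ultimately show ?thesis using that con by blast
qed

lemma components_meeting_connected:
  assumes "connected W" "W \<subseteq> S" "D \<in> components S" "D' \<in> components S" "D \<inter> W \<noteq> {}" "D' \<inter> W \<noteq> {}"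
  shows "D = D'"
proof -
  have "W \<subseteq> D" "W \<subseteq> D'" using assms by (meson components_maximal Int_commute)+
  then have "D \<inter> D' \<noteq> {}" using assms by blast
  then show ?thesis using assms components_nonoverlap by blast
qed

text \<open>A new component that meets neither side \<open>W1\<close> nor \<open>W2\<close> of the
  edge never reaches the edge, hence is an old component. The old component \<open>C\<close> around
  the edge disappears and at most two take its place.\<close>

lemma add_edge_upper:
  fixes K :: "point set"
  assumes K: "closed K" "K \<noteq> {}" and ab: "a \<noteq> b" and dis: "K \<inter> closed_segment a b = {a, b}"
    and fin: "finite (components (- K))"
  shows "finite (components (- (K \<union> closed_segment a b))) \<and>
    card (components (- (K \<union> closed_segment a b))) \<le> card (components (- K)) + 1"
proof -
  let ?e = "closed_segment a b"
  have "open_segment a b \<inter> K = {}" using dis by (auto simp: open_segment_def)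
  then obtain T W1 W2 where T: "open T" "connected T" "T \<inter> K = {}" "open_segment a b \<subseteq> T"
    and W: "connected W1" "connected W2" "T - ?e = W1 \<union> W2"
    using edge_neighbourhood[OF K ab] by metis
  let ?S = "- (K \<union> ?e)"
  have opS: "open ?S" using K closed_segment by (intro open_Compl closed_Un) auto
  have Wsub: "W1 \<subseteq> ?S" "W2 \<subseteq> ?S" using W T by blast+
  obtain p where p: "p \<in> open_segment a b" using ab by (metis ex_in_conv open_segment_eq_empty)
  define C where "C = connected_component_set (- K) p"
  have pC: "C \<in> components (- K)" "p \<in> C" using p T by (auto simp: C_def components_def)
  have other: "D \<in> components (- K) - {C}"
    if D: "D \<in> components ?S" and no: "D \<inter> W1 = {}" "D \<inter> W2 = {}" for D
  proof -
    obtain x where x: "x \<in> D" using D in_components_nonempty by blast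
    let ?D = "enclosing_component K D"
    have sub: "D \<subseteq> ?D" and comp: "?D \<in> components (- K)" using enclosing_component[OF D _ x, of K] by auto
    have opD: "open D" using D opS open_components by blast
    \<comment> \<open>Otherwise \<open>D\<close> has a boundary point inside its enclosing
      component. That point must lie on the open edge, so \<open>D\<close> enters the tube
      \<open>T\<close> and thereby one of its sides.\<close>
    have "?D \<subseteq> D"
    proof (rule ccontr)
      assume "\<not> ?D \<subseteq> D"
      then have "?D - D \<noteq> {}" by blast
      then have "?D \<inter> frontier D \<noteq> {}" using connected_Int_frontier[of ?D D] comp in_components_connected sub x by blast
      then obtain q where q: "q \<in> ?D" "q \<in> closure D" "q \<notin> D"
        using opD by (auto simp: frontier_def interior_open)
      have qK: "q \<notin> K" using q comp in_components_subset by blast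
      have "q \<in> ?e"
      proof (rule ccontr)
        assume "q \<notin> ?e"
        then have qS: "q \<in> ?S" using qK by blast
        let ?Q = "connected_component_set ?S q"
        have Q: "?Q \<in> components ?S" "q \<in> ?Q" using qS by (auto simp: components_def)
        then have "open ?Q" using opS open_components by blast
        then have "?Q \<inter> D \<noteq> {}" using q(2) Q(2) open_Int_closure_eq_empty by blast
        then have "?Q = D" using Q(1) D components_nonoverlap by blast
        then show False using Q q by blast
      qed
      then have "q \<in> T" using qK dis T by (auto simp: open_segment_def)
      then have "T \<inter> D \<noteq> {}" using q(2) T(1) open_Int_closure_eq_empty by blast
      moreover have "D \<inter> ?e = {}" using D in_components_subset by blast
      ultimately show False using W(3) no by blast
    qed
    then have "D = ?D" using sub by blast
    moreover have "p \<notin> D" using D p in_components_subset segment_open_subset_closed by blast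
    ultimately show ?thesis using comp pC by auto
  qed
  let ?N = "\<lambda>W. {D \<in> components ?S. D \<inter> W \<noteq> {}}"
  have N: "finite (?N W) \<and> card (?N W) \<le> 1" if "connected W" "W \<subseteq> ?S" for W
  proof (cases "?N W = {}")
    case True then show ?thesis by (metis card.empty finite.emptyI zero_le)
  next
    case False
    then obtain D where D: "D \<in> ?N W" by blast
    then have "?N W = {D}" using components_meeting_connected[OF that] by blast
    then show ?thesis by simp
  qed
  have sub: "components ?S \<subseteq> (components (- K) - {C}) \<union> (?N W1 \<union> ?N W2)"
    using other by blast
  have finU: "finite ((components (- K) - {C}) \<union> (?N W1 \<union> ?N W2))"
    using N[OF W(1) Wsub(1)] N[OF W(2) Wsub(2)] fin by simp
  have "card (components ?S) \<le> card ((components (- K) - {C}) \<union> (?N W1 \<union> ?N W2))"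
    using sub finU by (rule card_mono[rotated])
  also have "\<dots> \<le> card (components (- K) - {C}) + (card (?N W1) + card (?N W2))"
    using card_Un_le[of "components (- K) - {C}" "?N W1 \<union> ?N W2"] card_Un_le[of "?N W1" "?N W2"] by linarith
  also have "\<dots> \<le> (card (components (- K)) - 1) + (1 + 1)"
    using N[OF W(1) Wsub(1)] N[OF W(2) Wsub(2)] pC(1) fin by (intro add_mono) (auto simp: card_Diff_singleton)
  also have "\<dots> = card (components (- K)) + 1"
    using pC(1) fin card_gt_0_iff[of "components (- K)"] by auto
  finally show ?thesis using finite_subset[OF sub finU] by blast
qed

text \<open>An arc of \<open>K\<close> from \<open>a\<close> to \<open>b\<close> closes up with the edge to a Jordan curve separating its two sides.\<close>
lemma add_edge_lower:
  fixes K :: "point set"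
  assumes K: "closed K" "path_connected K" and ab: "a \<noteq> b" and dis: "K \<inter> closed_segment a b = {a, b}"
    and fin: "finite (components (- K))"
  shows "card (components (- K)) + 1 \<le> card (components (- (K \<union> closed_segment a b)))"
proof -
  let ?e = "closed_segment a b"
  have abK: "a \<in> K" "b \<in> K" using dis by auto
  have Kne: "K \<noteq> {}" using abK by auto
  let ?S = "- (K \<union> ?e)"
  have finS: "finite (components ?S)" using add_edge_upper[OF K(1) Kne ab dis fin] by blast
  have "open_segment a b \<inter> K = {}" using dis by (auto simp: open_segment_def)
  then obtain T W1 W2 where T: "open T" "connected T" "T \<inter> K = {}" "open_segment a b \<subseteq> T"
    and W: "connected W1" "connected W2" "T - ?e = W1 \<union> W2"
    using edge_neighbourhood[OF K(1) Kne ab] by metis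
  obtain g where g: "arc g" "path_image g \<subseteq> K" "pathstart g = a" "pathfinish g = b"
    using K(2) abK ab unfolding path_connected_arcwise by blast
  let ?c = "g +++ linepath b a"
  have "path_image g \<inter> path_image (linepath b a) \<subseteq> {pathstart g, pathstart (linepath b a)}"
    using g dis by (auto simp: closed_segment_commute)
  then have sp: "simple_path ?c"
    using g ab by (intro simple_path_join_loop) (auto intro: arc_linepath)
  have loop: "pathfinish ?c = pathstart ?c" using g by simp
  have im: "path_image ?c = path_image g \<union> ?e"
    using g by (simp add: path_image_join closed_segment_commute)
  obtain I Ou where IO: "open I" "open Ou" "I \<inter> Ou = {}" "I \<union> Ou = - path_image ?c"
    "\<And>T. \<lbrakk>open T; T \<inter> path_image ?c \<noteq> {}\<rbrakk> \<Longrightarrow> T \<inter> I \<noteq> {} \<and> T \<inter> Ou \<noteq> {}"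
    using Jordan_point[OF sp loop] by blast
  obtain p where p: "p \<in> open_segment a b" using ab by (metis ex_in_conv open_segment_eq_empty)
  have "p \<in> closed_segment a b" using p segment_open_subset_closed by blast
  then have "p \<in> T \<inter> path_image ?c" using p T im by blast
  then obtain x y where x: "x \<in> T" "x \<in> I" and y: "y \<in> T" "y \<in> Ou" using IO(5)[OF T(1)] by blast
  have xyS: "x \<in> ?S" "y \<in> ?S" using x y T(3) IO(4) im by blast+
  define D1 where "D1 = connected_component_set ?S x"
  define D2 where "D2 = connected_component_set ?S y"
  have D: "D1 \<in> components ?S" "D2 \<in> components ?S" "x \<in> D1" "y \<in> D2"
    using xyS by (auto simp: D1_def D2_def components_def)
  have "D1 \<noteq> D2"
  proof
    assume "D1 = D2"
    moreover have "connected D1" by (simp add: D1_def)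
    moreover have "D1 \<subseteq> I \<union> Ou" using D(1) in_components_subset im g(2) IO(4) by blast
    ultimately show False using connectedD[of D1 I Ou] IO(1-3) x y D by blast
  qed
  \<comment> \<open>The tube avoids \<open>K\<close>, so before the edge is added nothing separates
    \<open>x\<close> from \<open>y\<close>.\<close>
  moreover have "enclosing_component K D1 = enclosing_component K D2"
  proof -
    have "connected_component (- K) x y" using T x y by (auto simp: connected_component_def)
    then have "connected_component_set (- K) x = connected_component_set (- K) y"
      by (intro connected_component_eq) (simp add: connected_component_sym)
    then show ?thesis using enclosing_component(1)[OF D(1) _ D(3), of K] enclosing_component(1)[OF D(2) _ D(4), of K]
      by simp
  qed
  ultimately have "\<not> inj_on (enclosing_component K) (components ?S)" using D by (auto dest: inj_onD)
  then have "card (enclosing_component K ` components ?S) < card (components ?S)"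
    using finS by (metis card_image_le eq_card_imp_inj_on le_neq_implies_less)
  then show ?thesis using enclosing_component_surj[OF K(1)] by (metis Suc_eq_plus1 Suc_leI)
qed

text \<open>Induction on the number of hits. Up to the first hit \<open>t1\<close> the segment is a
  tail, between the first two hits it is an edge with both ends on \<open>K\<close>, and from
  \<open>t2\<close> on it has one hit fewer. So \<open>Suc n\<close> hits create at most
  \<open>n\<close> new components, and at least \<open>n\<close> if \<open>K\<close> is path
  connected.\<close>

lemma add_segment_aux:
  fixes K :: "point set" and a b :: point
  assumes ab: "a \<noteq> b"
  defines "P \<equiv> \<lambda>t. (1 - t) *\<^sub>R a + t *\<^sub>R b"
  assumes "compact K" "finite (components (- K))" "s \<le> 1" "card {t \<in> {s..1}. P t \<in> K} = Suc n"
  shows "finite (components (- (K \<union> P ` {s..1}))) \<and>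
    card (components (- (K \<union> P ` {s..1}))) \<le> card (components (- K)) + n \<and>
    (path_connected K \<longrightarrow> card (components (- K)) + n \<le> card (components (- (K \<union> P ` {s..1}))))"
  using assms(3-)
proof (induction n arbitrary: K s)
  have injP: "P t = P t' \<longleftrightarrow> t = t'" for t t'
  proof -
    have "P t - P t' = (t - t') *\<^sub>R (b - a)" by (simp add: P_def algebra_simps)
    then show ?thesis using ab by (metis eq_iff_diff_eq_0 scaleR_eq_0_iff)
  qed
  have segP: "P ` {t..t'} = closed_segment (P t) (P t')" if "t \<le> t'" for t t'
  proof -
    have lin: "P ((1 - r) * t + r * t') = (1 - r) *\<^sub>R P t + r *\<^sub>R P t'" for r
      by (simp add: P_def algebra_simps)
    have "closed_segment (P t) (P t') = (\<lambda>r. P ((1 - r) * t + r * t')) ` {0..1}"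
      unfolding closed_segment_image_interval lin ..
    also have "\<dots> = P ` closed_segment t t'" unfolding closed_segment_image_interval by auto
    finally show ?thesis using that by (simp add: closed_segment_eq_real_ivl)
  qed
  {
    case (0 K s)
    then obtain t where t: "{t \<in> {s..1}. P t \<in> K} = {t}" by (auto simp: card_1_singleton_iff)
    have "K \<inter> P ` {s..1} = P ` {t \<in> {s..1}. P t \<in> K}" by blast
    then have "K \<inter> P ` {s..1} = {P t}" unfolding t by simp
    then have "connected (K \<inter> closed_segment (P s) (P 1))" using segP[OF 0(3)] by simp
    from add_tail[OF 0(1) this 0(2)] show ?case using segP[OF 0(3)] by simp
  next
    case (Suc n K s)
    define U where "U = {t \<in> {s..1}. P t \<in> K}"
    have cU: "card U = Suc (Suc n)" using Suc.prems(4) by (simp add: U_def)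
    then have finU: "finite U" "U \<noteq> {}" using card.infinite by fastforce+
    define t1 where "t1 = Min U"
    define t2 where "t2 = Min (U - {t1})"
    have t1: "t1 \<in> U" "\<And>t. t \<in> U \<Longrightarrow> t1 \<le> t" using finU by (auto simp: t1_def)
    have cU1: "card (U - {t1}) = Suc n" using cU t1 by simp
    then have ne: "U - {t1} \<noteq> {}" by (metis card.empty nat.distinct(1))
    then have "t2 \<in> U - {t1}" using finU unfolding t2_def by (intro Min_in) auto
    then have t2: "t2 \<in> U" "t2 \<noteq> t1" by auto
    have t2_min: "t2 \<le> t" if "t \<in> U" "t \<noteq> t1" for t using that finU by (auto simp: t2_def)
    have ord: "s \<le> t1" "t1 < t2" "t2 \<le> 1" using t1 t2 by (auto simp: U_def le_less)
    have PK: "P t1 \<in> K" "P t2 \<in> K" using t1 t2 by (auto simp: U_def)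
    let ?K1 = "K \<union> P ` {s..t1}"
    let ?K2 = "?K1 \<union> P ` {t1..t2}"
    have UI: "t \<in> U" if "P t \<in> K" "s \<le> t" "t \<le> 1" for t using that by (simp add: U_def)
    have k1: "K \<inter> P ` {s..t1} = {P t1}"
    proof (intro equalityI subsetI)
      fix x assume "x \<in> K \<inter> P ` {s..t1}"
      then obtain t where t: "x = P t" "P t \<in> K" "s \<le> t" "t \<le> t1" by auto
      then have "t1 \<le> t" using t1(2)[OF UI[of t]] ord by simp
      then show "x \<in> {P t1}" using t by simp
    next
      fix x assume "x \<in> {P t1}"
      then show "x \<in> K \<inter> P ` {s..t1}" using PK ord by simp
    qed
    have k2: "?K1 \<inter> P ` {t1..t2} = {P t1, P t2}"
    proof (intro equalityI subsetI)
      fix x assume x: "x \<in> ?K1 \<inter> P ` {t1..t2}"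
      then have "x \<in> P ` {t1..t2}" by blast
      then obtain t where t: "x = P t" "t1 \<le> t" "t \<le> t2" by auto
      have "P t \<in> ?K1" using x unfolding t(1) by (rule IntD1)
      then have "t = t1 \<or> t = t2"
      proof
        assume "P t \<in> K"
        then have "t = t1 \<or> t2 \<le> t" using t2_min[OF UI[of t]] t ord by auto
        then show ?thesis using t by auto
      next
        assume "P t \<in> P ` {s..t1}"
        then obtain t' where "P t = P t'" "t' \<le> t1" by auto
        then show ?thesis using injP t by auto
      qed
      then show "x \<in> {P t1, P t2}" using t by auto
    next
      fix x assume "x \<in> {P t1, P t2}"
      then show "x \<in> ?K1 \<inter> P ` {t1..t2}" using PK ord by auto
    qed
    have K2: "?K2 = K \<union> P ` {s..t2}"
    proof -
      have "{s..t1} \<union> {t1..t2} = {s..t2}" using ord by auto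
      then show ?thesis by (metis Un_assoc image_Un)
    qed
    have K3: "?K2 \<union> P ` {t2..1} = K \<union> P ` {s..1}"
    proof -
      have "{s..t2} \<union> {t2..1} = {s..1}" using ord by auto
      then show ?thesis unfolding K2 by (metis Un_assoc image_Un)
    qed
    have cp: "compact (P ` {t..t'})" if "t \<le> t'" for t t' using segP[OF that] by simp
    have pc: "path_connected (P ` {t..t'})" if "t \<le> t'" for t t' using segP[OF that] by (simp add: convex_imp_path_connected)
    have cK: "compact ?K1" "compact ?K2" using Suc.prems(1) cp ord by (auto intro!: compact_Un)
    have pK1: "path_connected ?K1" if "path_connected K"
      using that k1 pc ord by (intro path_connected_Un) auto
    have pK2: "path_connected ?K2" if "path_connected K"
      by (rule path_connected_Un[OF pK1[OF that] pc]) (use k2 ord in auto)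
    have con1: "connected (K \<inter> closed_segment (P s) (P t1))" using k1 segP[OF ord(1)] by simp
    have st1: "finite (components (- ?K1)) \<and> card (components (- ?K1)) = card (components (- K))"
      using add_tail[OF Suc.prems(1) con1 Suc.prems(2)] segP[OF ord(1)] by simp
    have Pne: "P t1 \<noteq> P t2" using injP ord by simp
    have seg12: "P ` {t1..t2} = closed_segment (P t1) (P t2)" using segP ord by simp
    have dis: "?K1 \<inter> closed_segment (P t1) (P t2) = {P t1, P t2}" using k2 seg12 by simp
    have Kne: "?K1 \<noteq> {}" using PK by auto
    have st2: "finite (components (- ?K2)) \<and> card (components (- ?K2)) \<le> card (components (- ?K1)) + 1"
      using add_edge_upper[OF compact_imp_closed[OF cK(1)] Kne Pne dis] st1 seg12 by simp
    have st2': "card (components (- ?K1)) + 1 \<le> card (components (- ?K2))" if "path_connected K"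
      using add_edge_lower[OF compact_imp_closed[OF cK(1)] pK1[OF that] Pne dis] st1 seg12 by simp
    \<comment> \<open>The part drawn so far touches the rest only at \<open>t2\<close>, which was a
      hit already; only \<open>t1\<close> drops out.\<close>
    have "{t \<in> {t2..1}. P t \<in> ?K2} = U - {t1}"
    proof (intro equalityI subsetI)
      fix t assume t: "t \<in> {t \<in> {t2..1}. P t \<in> ?K2}"
      then have "P t \<in> K \<or> t \<le> t2" using injP unfolding K2 by auto
      then have "P t \<in> K" using t PK by (auto dest: order_antisym)
      then show "t \<in> U - {t1}" using t ord by (auto simp: U_def)
    next
      fix t assume "t \<in> U - {t1}"
      then show "t \<in> {t \<in> {t2..1}. P t \<in> ?K2}" using t2_min by (auto simp: U_def)
    qed
    then have cn: "card {t \<in> {t2..1}. P t \<in> ?K2} = Suc n" using cU1 by simp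
    have IH: "finite (components (- (?K2 \<union> P ` {t2..1}))) \<and>
      card (components (- (?K2 \<union> P ` {t2..1}))) \<le> card (components (- ?K2)) + n \<and>
      (path_connected ?K2 \<longrightarrow> card (components (- ?K2)) + n \<le> card (components (- (?K2 \<union> P ` {t2..1}))))"
      using Suc.IH[OF cK(2) _ ord(3) cn] st2 by blast
    show ?case using IH st1 st2 st2' pK2 unfolding K3 by auto
  }
qed

text \<open>Without any hit the truncated difference is 0, which is right: a segment disjoint from
  \<open>K\<close> leaves the number of components unchanged.\<close>

lemma add_segment:
  fixes K :: "point set"
  assumes "compact K" "finite (components (- K))" "finite (K \<inter> closed_segment a b)" "a \<noteq> b"
  shows "finite (components (- (K \<union> closed_segment a b)))"
    "card (components (- (K \<union> closed_segment a b))) \<le> card (components (- K)) + (card (K \<inter> closed_segment a b) - 1)"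
    "\<lbrakk>path_connected K; K \<inter> closed_segment a b \<noteq> {}\<rbrakk> \<Longrightarrow>
      card (components (- K)) + card (K \<inter> closed_segment a b) \<le> card (components (- (K \<union> closed_segment a b))) + 1"
proof -
  let ?e = "closed_segment a b"
  define P where "P t = (1 - t) *\<^sub>R a + t *\<^sub>R b" for t :: real
  have e: "?e = P ` {0..1}" unfolding closed_segment_image_interval P_def ..
  have inj: "inj_on P X" for X
  proof (rule inj_onI)
    fix t t' assume "P t = P t'"
    moreover have "P t - P t' = (t - t') *\<^sub>R (b - a)" by (simp add: P_def algebra_simps)
    ultimately show "t = t'" using assms(4) by (metis eq_iff_diff_eq_0 scaleR_eq_0_iff)
  qed
  have "K \<inter> ?e = P ` {t \<in> {0..1}. P t \<in> K}" unfolding e by auto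
  then have c: "card {t \<in> {0..1}. P t \<in> K} = card (K \<inter> ?e)" using inj by (simp add: card_image)
  have "finite (components (- (K \<union> ?e))) \<and>
    card (components (- (K \<union> ?e))) \<le> card (components (- K)) + (card (K \<inter> ?e) - 1) \<and>
    (path_connected K \<longrightarrow> K \<inter> ?e \<noteq> {} \<longrightarrow>
      card (components (- K)) + card (K \<inter> ?e) \<le> card (components (- (K \<union> ?e))) + 1)"
  proof (cases "K \<inter> ?e = {}")
    case True
    then show ?thesis using add_tail[OF assms(1) _ assms(2), of a b] by simp
  next
    case False
    then obtain n where n: "card (K \<inter> ?e) = Suc n" using assms(3) by (metis card_eq_0_iff not0_implies_Suc)
    show ?thesis
      using add_segment_aux[OF assms(4,1,2), of 0 n] c n unfolding e P_def by auto
  qed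
  then show "finite (components (- (K \<union> ?e)))"
    "card (components (- (K \<union> ?e))) \<le> card (components (- K)) + (card (K \<inter> ?e) - 1)"
    "\<lbrakk>path_connected K; K \<inter> ?e \<noteq> {}\<rbrakk> \<Longrightarrow> card (components (- K)) + card (K \<inter> ?e) \<le> card (components (- (K \<union> ?e))) + 1"
    by blast+
qed

section \<open>Parallel motions of segment systems\<close>

definition det2 :: "point \<Rightarrow> point \<Rightarrow> real" where
  "det2 u v = u$1 * v$2 - u$2 * v$1"

lemma point_eq_iff: "(u::point) = v \<longleftrightarrow> u$1 = v$1 \<and> u$2 = v$2"
  by (simp add: vec_eq_iff forall_2)

lemma det2_simps [simp]:
  "det2 u (x + y) = det2 u x + det2 u y"
  "det2 u (x - y) = det2 u x - det2 u y"
  "det2 u (r *\<^sub>R x) = r * det2 u x"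
  "det2 (x + y) u = det2 x u + det2 y u"
  "det2 (x - y) u = det2 x u - det2 y u"
  "det2 (r *\<^sub>R x) u = r * det2 x u"
  "det2 u (- x) = - det2 u x"
  "det2 u 0 = 0"
  "det2 u u = 0"
  by (simp_all add: det2_def algebra_simps)

lemma det2_commute: "det2 u v = - det2 v u"
  by (simp add: det2_def)

lemma det2_solve:
  assumes "det2 p q \<noteq> 0"
  obtains v where "det2 p v = a" "det2 q v = c"
proof
  let ?v = "((a / det2 p q) *\<^sub>R q - (c / det2 p q) *\<^sub>R p) :: point"
  have *: "det2 q p = - det2 p q" by (rule det2_commute)
  show "det2 p ?v = a" "det2 q ?v = c" using assms by (simp_all add: *)
qed

lemma det2_unique:
  assumes "det2 p q \<noteq> 0" "det2 p v = det2 p v'" "det2 q v = det2 q v'"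
  shows "v = v'"
proof -
  have z: "det2 p (v - v') = 0" "det2 q (v - v') = 0" using assms by simp_all
  have "det2 p q *\<^sub>R (v - v') = det2 p (v - v') *\<^sub>R q - det2 q (v - v') *\<^sub>R p"
    by (simp add: point_eq_iff det2_def algebra_simps)
  then show ?thesis using assms(1) z by simp
qed

lemma det2_eq_0_parallel:
  assumes "det2 p q = 0" "p \<noteq> 0"
  obtains r where "q = r *\<^sub>R p"
proof (cases "p$1 = 0")
  case True
  then have "p$2 \<noteq> 0" using assms(2) by (auto simp: point_eq_iff)
  then have "q = (q$2 / p$2) *\<^sub>R p" using True assms(1) by (auto simp: point_eq_iff det2_def)
  then show ?thesis using that by blast
next
  case False
  then have "q = (q$1 / p$1) *\<^sub>R p" using assms(1) by (auto simp: point_eq_iff det2_def field_simps)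
  then show ?thesis using that by blast
qed

text \<open>The Grassmann-Pluecker relation. It is the compatibility condition for three lines to
  move as under one common translation \<open>c\<close>.\<close>

lemma det2_pluecker: "det2 p c * det2 q r = det2 q c * det2 p r - det2 r c * det2 p q"
  by (simp add: det2_def algebra_simps)

lemma finite_obtains_min:
  fixes f :: "'a \<Rightarrow> real"
  assumes "finite S" "S \<noteq> {}"
  obtains x where "x \<in> S" "\<And>y. y \<in> S \<Longrightarrow> f x \<le> f y"
  using arg_min_if_finite(1)[OF assms, of f] arg_min_least[OF assms, of _ f] by blast

text \<open>Gaussian elimination: an equation \<open>e\<close> that involves the unknown
  \<open>t\<close> is solved for \<open>t\<close> and substituted into the others.\<close>

lemma finite_kernel_nonzero:
  fixes c :: "'e \<Rightarrow> 's \<Rightarrow> real"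
  assumes "finite E" "finite M" "card E < card M"
  shows "\<exists>w. (\<exists>s\<in>M. w s \<noteq> 0) \<and> (\<forall>e\<in>E. (\<Sum>s\<in>M. c e s * w s) = 0)"
  using assms
proof (induction E arbitrary: M c rule: finite_induct)
  case empty
  then have "M \<noteq> {}" by auto
  then show ?case by (intro exI[of _ "\<lambda>_. 1"]) auto
next
  case (insert e E)
  show ?case
  proof (cases "\<exists>s\<in>M. c e s \<noteq> 0")
    case False
    have "card E < card M" using insert by simp
    from insert.IH[OF insert.prems(1) this, of c] obtain w where
      "\<exists>s\<in>M. w s \<noteq> 0" "\<forall>e\<in>E. (\<Sum>s\<in>M. c e s * w s) = 0" by blast
    moreover have "(\<Sum>s\<in>M. c e s * w s) = 0" using False by simp
    ultimately show ?thesis by (intro exI[of _ w]) auto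
  next
    case True
    then obtain t where t: "t \<in> M" "c e t \<noteq> 0" by blast
    define c' where "c' f s = c f s - c f t * c e s / c e t" for f s
    have "card E < card (M - {t})" using insert t by simp
    from insert.IH[OF _ this, of c'] insert.prems obtain w where
      w: "\<exists>s\<in>M - {t}. w s \<noteq> 0" "\<forall>f\<in>E. (\<Sum>s\<in>M - {t}. c' f s * w s) = 0" by auto
    define a where "a = (\<Sum>s\<in>M - {t}. c e s * w s)"
    define w' where "w' = w(t := - a / c e t)"
    have split: "(\<Sum>s\<in>M. c f s * w' s) = (\<Sum>s\<in>M - {t}. c f s * w s) - c f t * a / c e t" for f
    proof -
      have "(\<Sum>s\<in>M. c f s * w' s) = c f t * w' t + (\<Sum>s\<in>M - {t}. c f s * w' s)"
        using insert.prems(1) t(1) by (rule sum.remove)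
      also have "(\<Sum>s\<in>M - {t}. c f s * w' s) = (\<Sum>s\<in>M - {t}. c f s * w s)"
        by (rule sum.cong) (auto simp: w'_def)
      finally show ?thesis by (simp add: w'_def)
    qed
    have "(\<Sum>s\<in>M. c f s * w' s) = 0" if "f \<in> E" for f
    proof -
      have "0 = (\<Sum>s\<in>M - {t}. c' f s * w s)" using w(2) that by simp
      also have "\<dots> = (\<Sum>s\<in>M - {t}. c f s * w s) - (\<Sum>s\<in>M - {t}. c f t / c e t * (c e s * w s))"
        unfolding sum_subtractf[symmetric] by (rule sum.cong) (auto simp: c'_def algebra_simps)
      also have "\<dots> = (\<Sum>s\<in>M - {t}. c f s * w s) - c f t / c e t * a"
        by (simp add: a_def sum_distrib_left)
      finally show ?thesis by (simp add: split)
    qed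
    moreover have "(\<Sum>s\<in>M. c e s * w' s) = 0" using t(2) by (simp add: split a_def)
    moreover have "\<exists>s\<in>M. w' s \<noteq> 0" using w(1) by (auto simp: w'_def)
    ultimately show ?thesis by (intro exI[of _ w']) auto
  qed
qed

text \<open>The line of \<open>s\<close> is \<open>det2 (d s) x = h s\<close>. A parallel motion
  changes only \<open>h\<close>, so it is a function \<open>w\<close> assigning each segment the
  rate of \<open>h s\<close>; the translation by \<open>c\<close> is
  \<open>w s = det2 (d s) c\<close>.\<close>

locale segment_lines =
  fixes M :: "point set set" and d :: "point set \<Rightarrow> point" and h :: "point set \<Rightarrow> real"
  assumes sys: "segment_system M"
    and dir_nz: "s \<in> M \<Longrightarrow> d s \<noteq> 0"
    and on_line: "s \<in> M \<Longrightarrow> x \<in> s \<Longrightarrow> det2 (d s) x = h s"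
    and cross_det: "\<lbrakk>s \<in> M; t \<in> M; s \<noteq> t; x \<in> s; x \<in> t\<rbrakk> \<Longrightarrow> det2 (d s) (d t) \<noteq> 0"

lemma segment_system_lines:
  assumes "segment_system M"
  obtains d h where "segment_lines M d h"
proof -
  have "\<forall>s\<in>M. \<exists>ab. fst ab \<noteq> snd ab \<and> s = closed_segment (fst ab) (snd ab)"
    using assms unfolding segment_system_def by auto
  then obtain e where e: "\<forall>s\<in>M. fst (e s) \<noteq> snd (e s) \<and> s = closed_segment (fst (e s)) (snd (e s))"
    by metis
  define d where "d s = snd (e s) - fst (e s)" for s
  define h where "h s = det2 (d s) (fst (e s))" for s
  have nz: "d s \<noteq> 0" if "s \<in> M" for s using e that by (metis d_def right_minus_eq)
  have on: "det2 (d s) x = h s" if "s \<in> M" "x \<in> s" for s x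
  proof -
    have "x \<in> closed_segment (fst (e s)) (snd (e s))" using e that by blast
    then obtain u where "x = (1 - u) *\<^sub>R fst (e s) + u *\<^sub>R snd (e s)" by (auto simp: in_segment)
    then have "x = fst (e s) + u *\<^sub>R d s" by (simp add: d_def algebra_simps)
    then show ?thesis by (simp add: h_def)
  qed
  have "det2 (d s) (d t) \<noteq> 0" if st: "s \<in> M" "t \<in> M" "s \<noteq> t" "x \<in> s" "x \<in> t" for s t x
  proof
    \<comment> \<open>Parallel segments with a common point lie on one line, which the merging
      convention excludes.\<close>
    assume 0: "det2 (d s) (d t) = 0"
    obtain r where r: "d t = r *\<^sub>R d s" using det2_eq_0_parallel[OF 0 nz[OF st(1)]] .
    then have r0: "r \<noteq> 0" using nz[OF st(2)] by auto
    have line: "det2 (d s) y = det2 (d s) x" if "y \<in> s \<union> t" for y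
    proof (cases "y \<in> s")
      case True then show ?thesis using on st by simp
    next
      case False
      then have "det2 (d t) y = det2 (d t) x" using on st that by simp
      then show ?thesis using r r0 by simp
    qed
    have "collinear (s \<union> t)" unfolding collinear_def
    proof (intro exI[of _ "d s"] ballI)
      fix y z assume "y \<in> s \<union> t" "z \<in> s \<union> t"
      then have "det2 (d s) (y - z) = 0" using line by simp
      then show "\<exists>c. y - z = c *\<^sub>R d s" using det2_eq_0_parallel nz[OF st(1)] by metis
    qed
    then have "s \<inter> t = {}" using assms st unfolding segment_system_def by blast
    then show False using st by blast
  qed
  then have "segment_lines M d h" using assms nz on by unfold_locales auto
  then show ?thesis using that by blast
qed

context segment_lines
begin

lemma finite_M: "finite M" using sys by (simp add: segment_system_def)

lemma convex_mem: "s \<in> M \<Longrightarrow> convex s"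
  using sys by (auto simp: segment_system_def)

lemma meet_unique:
  assumes "s \<in> M" "t \<in> M" "s \<noteq> t" "x \<in> s" "x \<in> t" "y \<in> s" "y \<in> t"
  shows "x = y"
  using det2_unique[OF cross_det[OF assms(1-5)]] on_line assms by metis

lemma finite_meet:
  assumes "s \<in> M" "t \<in> M" "s \<noteq> t"
  shows "finite (s \<inter> t)"
proof (cases "s \<inter> t = {}")
  case False
  then obtain x where "x \<in> s" "x \<in> t" by auto
  then have "s \<inter> t \<subseteq> {x}" using meet_unique assms by blast
  then show ?thesis using finite_subset by blast
qed simp

lemma finite_crossing_points: "finite (crossing_points M)"
proof -
  have "crossing_points M = (\<Union>s\<in>M. \<Union>t\<in>M - {s}. s \<inter> t)"
    by (auto simp: crossing_points_def)
  moreover have "finite (\<Union>s\<in>M. \<Union>t\<in>M - {s}. s \<inter> t)"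
    by (intro finite_UN_I finite_meet) (use finite_M in auto)
  ultimately show ?thesis by simp
qed

lemma crossing_pointI: "\<lbrakk>s \<in> M; t \<in> M; s \<noteq> t; x \<in> s; x \<in> t\<rbrakk> \<Longrightarrow> x \<in> crossing_points M"
  by (auto simp: crossing_points_def)

lemma crossing_point_other:
  assumes "x \<in> crossing_points M"
  obtains t where "t \<in> M" "t \<noteq> s" "x \<in> t"
  using assms by (auto simp: crossing_points_def)

text \<open>The endpoints of \<open>s\<close> are extreme points, so a vertex strictly inside
  \<open>s\<close> is due to another segment, possibly one that merely ends there.\<close>

lemma inner_vertex_other:
  assumes "s \<in> M" "X \<in> seg_verts M" "X \<in> open_segment x y" "x \<in> s" "y \<in> s"
  obtains t where "t \<in> M" "t \<noteq> s" "X \<in> t"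
proof (cases "X \<in> crossing_points M")
  case True then show ?thesis using that crossing_point_other by metis
next
  case False
  then obtain b where b: "closed_segment X b \<in> M" using assms by (auto simp: seg_verts_def segment_endpoints_def)
  have "closed_segment X b \<noteq> s"
  proof
    assume s: "closed_segment X b = s"
    have "X extreme_point_of (closed_segment X b)" by (simp add: extreme_point_of_segment)
    then show False using assms s unfolding extreme_point_of_def by blast
  qed
  then show ?thesis using that[of "closed_segment X b"] b by simp
qed

lemma not_edge_inner_vertex:
  assumes "s \<in> M" "x \<in> s" "y \<in> s" "x \<in> crossing_points M" "y \<in> crossing_points M" "x \<noteq> y" "{x, y} \<notin> seg_edges M"
  obtains X t where "X \<in> open_segment x y" "X \<in> s" "t \<in> M" "t \<noteq> s" "X \<in> t"
proof -
  have "x \<in> seg_verts M" "y \<in> seg_verts M" using assms by (auto simp: seg_verts_def)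
  then obtain X where X: "X \<in> seg_verts M" "X \<in> s" "X \<in> open_segment x y"
    using assms unfolding seg_edges_def by blast
  then show ?thesis using that inner_vertex_other[OF assms(1) X(1,3) assms(2,3)] by metis
qed

text \<open>
  The segment \<open>i\<close> meets \<open>j\<close> and \<open>k\<close>, its crossing with \<open>k\<close> is as close as possible to the point \<open>z\<close>
  where the lines of \<open>j\<close> and \<open>k\<close> meet, and the three lines move like a rigid translation by \<open>c\<close>.
\<close>
definition nearest_rigid :: "(point set \<Rightarrow> real) \<Rightarrow> point set \<Rightarrow> point set \<Rightarrow> point set \<Rightarrow> bool" where
  "nearest_rigid w j k i \<longleftrightarrow> i \<in> M \<and> i \<inter> j \<noteq> {} \<and> i \<inter> k \<noteq> {}
     \<and> (\<exists>c. det2 (d i) c = w i \<and> det2 (d j) c = w j \<and> det2 (d k) c = w k)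
     \<and> (\<forall>z. det2 (d j) z = h j \<and> det2 (d k) z = h k \<longrightarrow> z \<notin> k
          \<and> (\<forall>i'\<in>M. i' \<inter> j \<noteq> {} \<longrightarrow> (\<forall>y0\<in>i \<inter> k. \<forall>y\<in>i' \<inter> k. dist z y0 \<le> dist z y)))"

end

text \<open>\<open>v x\<close> is the velocity of the crossing point \<open>x\<close> when the line of \<open>s\<close> moves with velocity \<open>w s\<close>.\<close>
locale segment_flow = segment_lines +
  fixes w :: "point set \<Rightarrow> real" and v :: "point \<Rightarrow> point"
  assumes field: "\<lbrakk>s \<in> M; x \<in> crossing_points M; x \<in> s\<rbrakk> \<Longrightarrow> det2 (d s) (v x) = w s"
    and par: "\<lbrakk>j \<in> M; k \<in> M; j \<inter> k = {}; det2 (d j) (d k) = 0\<rbrakk> \<Longrightarrow> w j *\<^sub>R d k = w k *\<^sub>R d j"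
    and mis: "\<lbrakk>j \<in> M; k \<in> M; j \<inter> k = {}; det2 (d j) (d k) \<noteq> 0; i \<in> M; i \<inter> j \<noteq> {}; i \<inter> k \<noteq> {}\<rbrakk>
       \<Longrightarrow> \<exists>i. nearest_rigid w j k i \<or> nearest_rigid w k j i"
begin

text \<open>Both points stay on the moving line of \<open>s\<close>, so their relative velocity is
  parallel to it.\<close>

lemma flow_ratio:
  assumes "s \<in> M" "x \<in> crossing_points M" "x \<in> s" "y \<in> crossing_points M" "y \<in> s" "x \<noteq> y"
  obtains r where "v x - v y = r *\<^sub>R (x - y)"
proof -
  have "det2 (d s) (x - y) = 0" "det2 (d s) (v x - v y) = 0" using assms on_line field by simp_all
  then obtain a c where a: "x - y = a *\<^sub>R d s" and c: "v x - v y = c *\<^sub>R d s"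
    using det2_eq_0_parallel dir_nz assms(1) by metis
  have "a \<noteq> 0" using a assms by auto
  then have "v x - v y = (c / a) *\<^sub>R (x - y)" using a c by simp
  then show ?thesis using that by blast
qed

definition ratios :: "real set" where
  "ratios = {r. \<exists>s\<in>M. \<exists>x\<in>crossing_points M \<inter> s. \<exists>y\<in>crossing_points M \<inter> s. x \<noteq> y \<and> v x - v y = r *\<^sub>R (x - y)}"

lemma finite_ratios: "finite ratios"
proof -
  have "ratios \<subseteq> (\<lambda>(x, y). ((v x - v y) \<bullet> (x - y)) / ((x - y) \<bullet> (x - y))) ` (crossing_points M \<times> crossing_points M)"
  proof
    fix r assume "r \<in> ratios"
    then obtain x y where xy: "x \<in> crossing_points M" "y \<in> crossing_points M" "x \<noteq> y" "v x - v y = r *\<^sub>R (x - y)"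
      by (auto simp: ratios_def)
    then have "r = ((v x - v y) \<bullet> (x - y)) / ((x - y) \<bullet> (x - y))" by simp
    then show "r \<in> (\<lambda>(x, y). ((v x - v y) \<bullet> (x - y)) / ((x - y) \<bullet> (x - y))) ` (crossing_points M \<times> crossing_points M)"
      using xy by (intro image_eqI[of _ _ "(x, y)"]) auto
  qed
  then show ?thesis using finite_crossing_points by (meson finite_SigmaI finite_imageI finite_subset)
qed

end

section \<open>Pairs of crossing points that separate at the maximal rate\<close>

locale segment_flow_max = segment_flow +
  fixes R :: real
  assumes R_pos: "R > 0" and R_max: "r \<in> ratios \<Longrightarrow> r \<le> R"
begin

text \<open>Velocity in a frame expanding at rate \<open>R\<close>: points of a common segment have
  equal \<open>u\<close> exactly when they separate at rate \<open>R\<close>, and otherwise approach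
  each other in this frame.\<close>

definition u :: "point \<Rightarrow> point" where "u x = v x - R *\<^sub>R x"

lemma u_contracts:
  assumes "s \<in> M" "x \<in> crossing_points M" "x \<in> s" "y \<in> crossing_points M" "y \<in> s"
  obtains q where "q \<ge> 0" "u x - u y = - q *\<^sub>R (x - y)"
proof (cases "x = y")
  case True then show ?thesis using that[of 0] by simp
next
  case False
  then obtain r where r: "v x - v y = r *\<^sub>R (x - y)" using flow_ratio assms by blast
  then have "r \<in> ratios" using assms False by (auto simp: ratios_def)
  then have "R - r \<ge> 0" using R_max by simp
  moreover have "u x - u y = - (R - r) *\<^sub>R (x - y)"
    using r by (simp add: u_def algebra_simps)
  ultimately show ?thesis using that by blast
qed

text \<open>The right side does not depend on \<open>x\<close>; so values of \<open>u\<close> can be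
  compared between segments through their lines alone.\<close>

lemma u_line:
  assumes "s \<in> M" "x \<in> crossing_points M" "x \<in> s"
  shows "det2 (d s) (u x) = w s - R * h s"
  using assms field on_line by (simp add: u_def)

text \<open>
  The triangle of \<open>i0\<close>, \<open>j\<close>, \<open>k\<close> keeps its size while that of \<open>i\<close>, \<open>j\<close>, \<open>k\<close> grows at rate \<open>R\<close>, so \<open>y0\<close>
  and the farther point \<open>y\<close> separate along \<open>k\<close> faster than \<open>R\<close> allows.
\<close>
lemma nearest_rigid_contradiction:
  assumes i: "i \<in> M" and jk: "j \<in> M" "k \<in> M" "j \<inter> k = {}" "det2 (d j) (d k) \<noteq> 0"
    and x: "x \<in> i" "x \<in> j" and y: "y \<in> i" "y \<in> k" and eq: "u x = u y"
    and near: "nearest_rigid w j k i0"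
  shows False
proof -
  have ne: "i \<noteq> j" "i \<noteq> k" "j \<noteq> k" using x y jk by auto
  have xP: "x \<in> crossing_points M" using crossing_pointI i jk x ne by blast
  have yP: "y \<in> crossing_points M" using crossing_pointI i jk y ne by blast
  obtain c y0 where i0: "i0 \<in> M" "i0 \<inter> j \<noteq> {}"
    and c: "det2 (d i0) c = w i0" "det2 (d j) c = w j" "det2 (d k) c = w k"
    and y0: "y0 \<in> i0" "y0 \<in> k"
    using near unfolding nearest_rigid_def by blast
  have ne0: "i0 \<noteq> k" using i0 jk by auto
  have y0P: "y0 \<in> crossing_points M" using crossing_pointI i0 jk y0 ne0 by blast
  have vy0: "v y0 = c"
    using det2_unique[OF cross_det[OF i0(1) jk(2) ne0 y0]] field y0P y0 i0 jk c by metis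
  obtain z where z: "det2 (d j) z = h j" "det2 (d k) z = h k" using det2_solve[OF jk(4)] .
  have zk: "z \<notin> k" and zmin: "dist z y0 \<le> dist z y"
    using near z i x y y0 unfolding nearest_rigid_def by blast+
  \<comment> \<open>The intersection \<open>z\<close> of the two lines moves with velocity
    \<open>c\<close>, so the right side is the value that \<open>u\<close> would have at
    \<open>z\<close>.\<close>
  have "u y = c - R *\<^sub>R z"
  proof (rule det2_unique[OF jk(4)])
    show "det2 (d j) (u y) = det2 (d j) (c - R *\<^sub>R z)"
      using u_line[OF jk(1) xP x(2)] eq c z by simp
    show "det2 (d k) (u y) = det2 (d k) (c - R *\<^sub>R z)"
      using u_line[OF jk(2) yP y(2)] c z by simp
  qed
  moreover have "u y0 = c - R *\<^sub>R y0" by (simp add: u_def vy0)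
  ultimately have diff: "u y - u y0 = R *\<^sub>R (y0 - z)" by (simp add: algebra_simps)
  obtain q where q: "q \<ge> 0" "u y - u y0 = - q *\<^sub>R (y - y0)"
    using u_contracts[OF jk(2) yP y(2) y0P y0(2)] .
  have y0z: "y0 \<noteq> z" using zk y0 by auto
  have q0: "q > 0" using q diff y0z R_pos by (cases "q = 0") auto
  \<comment> \<open>\<open>T\<close> locates \<open>y\<close> on the ray from \<open>y0\<close>
    through \<open>z\<close>. Minimality of \<open>y0\<close> excludes \<open>T < 2\<close>; for
    \<open>T \<ge> 2\<close> the point \<open>z\<close> lies between \<open>y0\<close> and
    \<open>y\<close>, hence on \<open>k\<close>.\<close>
  define T where "T = R / q"
  have T0: "T > 0" using q0 R_pos by (simp add: T_def)
  have "q *\<^sub>R (y - y0) = R *\<^sub>R (z - y0)" using q diff by (simp add: algebra_simps)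
  then have "(1 / q) *\<^sub>R (q *\<^sub>R (y - y0)) = (1 / q) *\<^sub>R (R *\<^sub>R (z - y0))" by simp
  then have yT: "y - y0 = T *\<^sub>R (z - y0)" using q0 by (simp add: T_def)
  then have zy: "z - y = (1 - T) *\<^sub>R (z - y0)" by (simp add: algebra_simps)
  have "norm (z - y0) \<le> \<bar>1 - T\<bar> * norm (z - y0)" using zmin zy by (simp add: dist_norm)
  then have "1 \<le> \<bar>1 - T\<bar>" using y0z by simp
  then have T2: "T \<ge> 2" using T0 by linarith
  have "z = (1 - 1 / T) *\<^sub>R y0 + (1 / T) *\<^sub>R y"
  proof -
    have "(1 / T) *\<^sub>R (y - y0) = z - y0" using yT T0 by simp
    then show ?thesis by (simp add: algebra_simps)
  qed
  then have "z \<in> closed_segment y0 y" using T2 by (auto simp: in_segment intro!: exI[of _ "1 / T"])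
  then have "z \<in> k" using convex_mem[OF jk(2)] y y0 by (meson closed_segment_subset subsetD)
  then show False using zk by blast
qed

text \<open>If \<open>j\<close> and \<open>k\<close> were disjoint, the equation of this pair would
  contradict the growth of the gap between \<open>x\<close> and \<open>y\<close>. Once they meet,
  their two lines determine \<open>u\<close> at the common point.\<close>

lemma tight_pair_cross:
  assumes i: "i \<in> M" and jk: "j \<in> M" "k \<in> M" "j \<noteq> i" "k \<noteq> i"
    and x: "x \<in> i" "x \<in> j" and y: "y \<in> i" "y \<in> k" and xy: "x \<noteq> y" and eq: "u x = u y"
  obtains A where "A \<in> j" "A \<in> k" "u A = u x" "j \<noteq> k" "A \<in> crossing_points M"
proof -
  have jnk: "j \<noteq> k" using meet_unique[OF i jk(1) _ x, of y] y jk xy by auto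
  have xP: "x \<in> crossing_points M" using crossing_pointI[OF i jk(1) _ x] jk by auto
  have yP: "y \<in> crossing_points M" using crossing_pointI[OF i jk(2) _ y] jk by auto
  have "j \<inter> k \<noteq> {}"
  proof
    assume dis: "j \<inter> k = {}"
    show False
    proof (cases "det2 (d j) (d k) = 0")
      case False
      then have False': "det2 (d k) (d j) \<noteq> 0" using det2_commute[of "d j" "d k"] by simp
      from mis[OF jk(1,2) dis False i] x y obtain i0 where
        "nearest_rigid w j k i0 \<or> nearest_rigid w k j i0" by blast
      then show False
        using nearest_rigid_contradiction[OF i jk(1,2) dis False x y eq]
          nearest_rigid_contradiction[OF i jk(2,1) _ False' y x eq[symmetric]] dis by blast
    next
      \<comment> \<open>Parallel lines keep their distance, while tightness makes it grow at rate
        \<open>R\<close>. So the distance is 0 and \<open>y\<close> lies on the line of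
        \<open>j\<close>, which \<open>i\<close> meets only in \<open>x\<close>.\<close>
      case True
      obtain r where r: "d k = r *\<^sub>R d j" using det2_eq_0_parallel[OF True dir_nz[OF jk(1)]] .
      then have r0: "r \<noteq> 0" using dir_nz[OF jk(2)] by auto
      have "w j *\<^sub>R (r *\<^sub>R d j) = w k *\<^sub>R d j" using par[OF jk(1,2) dis True] r by simp
      then have wk: "w k = r * w j" using dir_nz[OF jk(1)] by (simp add: mult.commute)
      have "w k - R * h k = r * (w j - R * h j)"
        using u_line[OF jk(1) xP x(2)] u_line[OF jk(2) yP y(2)] eq r by simp
      then have hk: "h k = r * h j" using wk R_pos by (simp add: algebra_simps)
      have "det2 (d j) y = h j" using on_line[OF jk(2) y(2)] r r0 hk by simp
      then have "x = y"
        using det2_unique[OF cross_det[OF i jk(1) _ x], of x y] on_line i jk x y by metis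
      then show False using xy by simp
    qed
  qed
  then obtain A where A: "A \<in> j" "A \<in> k" by blast
  have AP: "A \<in> crossing_points M" using crossing_pointI[OF jk(1,2) jnk A] .
  have "u A = u x"
  proof (rule det2_unique[OF cross_det[OF jk(1,2) jnk A]])
    show "det2 (d j) (u A) = det2 (d j) (u x)" using u_line jk AP A xP x by simp
    show "det2 (d k) (u A) = det2 (d k) (u x)" using u_line jk AP A yP y eq by simp
  qed
  then show ?thesis using that A jnk AP by blast
qed

definition tight_triangle :: "point \<Rightarrow> point \<Rightarrow> point \<Rightarrow> bool" where
  "tight_triangle x y A \<longleftrightarrow> u x = u y \<and> u A = u x \<and> det2 (y - x) (A - x) \<noteq> 0
     \<and> (\<exists>i\<in>M. \<exists>j\<in>M. \<exists>k\<in>M. i \<noteq> j \<and> j \<noteq> k \<and> i \<noteq> k \<and> x \<in> i \<and> y \<in> i \<and> x \<in> j \<and> A \<in> j \<and> y \<in> k \<and> A \<in> k)"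

text \<open>Twice the Euclidean area, which is enough for comparing triangles.\<close>

definition area :: "point \<Rightarrow> point \<Rightarrow> point \<Rightarrow> real" where
  "area x y A = \<bar>det2 (y - x) (A - x)\<bar>"

lemma area_perm: "area y x A = area x y A" "area x A y = area x y A"
  by (simp_all add: area_def det2_def algebra_simps)

lemma tight_triangle_perm:
  assumes "tight_triangle x y A"
  shows "tight_triangle y x A" "tight_triangle x A y"
proof -
  obtain i j k where *: "i \<in> M" "j \<in> M" "k \<in> M" "i \<noteq> j" "j \<noteq> k" "i \<noteq> k"
    "x \<in> i" "y \<in> i" "x \<in> j" "A \<in> j" "y \<in> k" "A \<in> k" "u x = u y" "u A = u x"
    and nz: "area x y A \<noteq> 0"
    using assms unfolding tight_triangle_def area_def abs_eq_0 by blast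
  have "area y x A \<noteq> 0" "area x A y \<noteq> 0" using nz area_perm by simp_all
  then have det: "det2 (x - y) (A - y) \<noteq> 0" "det2 (A - x) (y - x) \<noteq> 0" unfolding area_def abs_eq_0 .
  show "tight_triangle y x A" unfolding tight_triangle_def
    using * det(1) by (intro conjI bexI[of _ i] bexI[of _ k] bexI[of _ j]) simp_all
  show "tight_triangle x A y" unfolding tight_triangle_def
    using * det(2) by (intro conjI bexI[of _ j] bexI[of _ i] bexI[of _ k]) simp_all
qed

lemma triangle_crossing_points:
  assumes "tight_triangle x y A"
  shows "x \<in> crossing_points M" "y \<in> crossing_points M" "A \<in> crossing_points M"
proof -
  obtain i j k where "i \<in> M" "j \<in> M" "k \<in> M" "i \<noteq> j" "j \<noteq> k" "i \<noteq> k"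
    "x \<in> i" "y \<in> i" "x \<in> j" "A \<in> j" "y \<in> k" "A \<in> k"
    using assms unfolding tight_triangle_def by blast
  then show "x \<in> crossing_points M" "y \<in> crossing_points M" "A \<in> crossing_points M"
    using crossing_pointI[of i j x] crossing_pointI[of i k y] crossing_pointI[of j k A] by auto
qed

text \<open>The line of \<open>t\<close> has \<open>x\<close> strictly on one side and
  \<open>A\<close> on the other or on the line itself, so \<open>t\<close> cuts off the corner at
  \<open>x\<close>, a fraction \<open>l * m\<close> of the area. If \<open>A\<close> lies on
  \<open>t\<close> then \<open>m = 1\<close>, and \<open>l < 1\<close> still makes the corner
  strictly smaller.\<close>

lemma tight_triangle_corner:
  assumes ijt: "i \<in> M" "j \<in> M" "t \<in> M" "i \<noteq> j" "t \<noteq> i" "t \<noteq> j"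
    and x: "x \<in> i" "x \<in> j" and A: "A \<in> j" and Y: "Y \<in> j" "Y \<in> t"
    and X: "X \<in> i" "X \<in> t" "X = x + l *\<^sub>R (y - x)" "0 < l" "l < 1"
    and u: "u X = u x" "u Y = u x" and nz: "det2 (y - x) (A - x) \<noteq> 0"
    and side: "(det2 (d t) x - h t) * (det2 (d t) A - h t) \<le> 0" and fx: "det2 (d t) x \<noteq> h t"
  shows "tight_triangle x X Y \<and> area x X Y < area x y A"
proof -
  define f where "f p = det2 (d t) p - h t" for p
  define m where "m = f x / (f x - f A)"
  have fx0: "f x \<noteq> 0" using fx by (simp add: f_def)
  have sd: "f x * f A \<le> 0" using side by (simp add: f_def)
  have den: "f x - f A \<noteq> 0"
  proof
    assume "f x - f A = 0"
    then have "f x * f A = f x * f x" by simp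
    then show False using sd fx0 by (metis antisym mult_eq_0_iff zero_le_square)
  qed
  have m: "0 < m" "m \<le> 1"
  proof -
    consider "f x > 0" "f A \<le> 0" | "f x < 0" "f A \<ge> 0" using sd fx0 by (auto simp: mult_le_0_iff)
    then show "0 < m" "m \<le> 1" by (cases; simp add: m_def field_simps)+
  qed
  have YA: "Y = x + m *\<^sub>R (A - x)"
  proof (rule det2_unique[OF cross_det[OF ijt(2,3) _ Y]])
    show "j \<noteq> t" using ijt by simp
    show "det2 (d j) Y = det2 (d j) (x + m *\<^sub>R (A - x))" using on_line ijt x A Y by simp
    have "f x + m * (f A - f x) = 0" using den by (simp add: m_def field_simps)
    then show "det2 (d t) Y = det2 (d t) (x + m *\<^sub>R (A - x))"
      using on_line[OF ijt(3) Y(2)] by (simp add: f_def algebra_simps)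
  qed
  have det: "det2 (X - x) (Y - x) = l * m * det2 (y - x) (A - x)"
    unfolding X(3) YA by (simp add: algebra_simps)
  have lm: "0 < l * m" "l * m < 1" using m X mult_less_le_imp_less[of l 1 m 1] by auto
  have "tight_triangle x X Y"
    unfolding tight_triangle_def
  proof (intro conjI bexI)
    show "det2 (X - x) (Y - x) \<noteq> 0" unfolding det using lm(1) nz by (metis less_irrefl mult_eq_0_iff)
    show "j \<noteq> t" "i \<noteq> t" using ijt by auto
  qed (use u ijt x X(1,2) Y in simp_all)
  moreover have "area x X Y < area x y A"
  proof -
    have "area x X Y = l * m * area x y A" unfolding area_def det abs_mult using m(1) X(4) by simp
    moreover have "area x y A > 0" using nz by (simp add: area_def)
    ultimately show ?thesis using lm by (simp add: mult_less_cancel_right1)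
  qed
  ultimately show ?thesis ..
qed

lemma subdivided_side_smaller:
  assumes tri: "tight_triangle x y A" and e: "{x, y} \<notin> seg_edges M"
  shows "\<exists>x' y' A'. tight_triangle x' y' A' \<and> area x' y' A' < area x y A"
proof -
  obtain i j k where ijk: "i \<in> M" "j \<in> M" "k \<in> M" "i \<noteq> j" "j \<noteq> k" "i \<noteq> k"
    and x: "x \<in> i" "x \<in> j" and y: "y \<in> i" "y \<in> k" and A: "A \<in> j" "A \<in> k"
    and eq: "u x = u y" "u A = u x" and nz: "det2 (y - x) (A - x) \<noteq> 0"
    using tri unfolding tight_triangle_def by blast
  note P = triangle_crossing_points[OF tri]
  have xy: "x \<noteq> y" using nz by (auto simp: det2_def)
  obtain X t where X: "X \<in> open_segment x y" "X \<in> i" and t: "t \<in> M" "t \<noteq> i" "X \<in> t"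
    using not_edge_inner_vertex[OF ijk(1) x(1) y(1) P(1,2) xy e] .
  obtain l where l: "0 < l" "l < 1" "X = (1 - l) *\<^sub>R x + l *\<^sub>R y" using X by (auto simp: in_segment)
  have Xl: "X = x + l *\<^sub>R (y - x)" "X = y + (1 - l) *\<^sub>R (x - y)" using l(3) by (simp_all add: algebra_simps)
  have XP: "X \<in> crossing_points M" using crossing_pointI[OF ijk(1) t(1) _ X(2) t(3)] t by simp
  obtain q where q: "q \<ge> 0" "u X - u x = - q *\<^sub>R (X - x)" using u_contracts[OF ijk(1) XP X(2) P(1) x(1)] .
  obtain q' where q': "q' \<ge> 0" "u X - u y = - q' *\<^sub>R (X - y)" using u_contracts[OF ijk(1) XP X(2) P(2) y(1)] .
  \<comment> \<open>\<open>X\<close> lies between \<open>x\<close> and \<open>y\<close>, so the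
    contractions relative to the two ends point in opposite directions; as \<open>u x = u y\<close>,
    both rates vanish.\<close>
  have "X - x = l *\<^sub>R (y - x)" "X - y = (l - 1) *\<^sub>R (y - x)" using Xl by (simp_all add: algebra_simps)
  then have "q * l = q' * (l - 1)" using q q' eq xy by auto
  moreover have "q' * (l - 1) \<le> 0" using q' l by (simp add: mult_nonneg_nonpos)
  moreover have "q * l \<ge> 0" using q l by simp
  ultimately have "q = 0" using l by (metis antisym less_irrefl mult_eq_0_iff)
  then have uX: "u X = u x" using q by simp
  have Xne: "X \<noteq> x" "X \<noteq> y" using X(1) by (auto simp: open_segment_def)
  \<comment> \<open>Now \<open>X\<close> forms tight pairs with \<open>x\<close> and with
    \<open>y\<close>, so \<open>t\<close> is forced to meet both other segments.\<close>
  obtain Y where Y: "Y \<in> j" "Y \<in> t" "u Y = u x" "j \<noteq> t"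
    using tight_pair_cross[OF ijk(1,2) t(1) _ t(2) x X(2) t(3) _ uX[symmetric]] ijk Xne by metis
  obtain Z where Z: "Z \<in> k" "Z \<in> t" "u Z = u y" "k \<noteq> t"
    using tight_pair_cross[OF ijk(1,3) t(1) _ t(2) y X(2) t(3)] ijk Xne uX eq by metis
  define f where "f p = det2 (d t) p - h t" for p
  have fX: "f X = 0" using on_line t by (simp add: f_def)
  have fx0: "f x \<noteq> 0"
  proof
    assume "f x = 0"
    then have "X = x" using det2_unique[OF cross_det[OF ijk(1) t(1) _ X(2) t(3)], of X x] t on_line ijk x X
      by (metis eq_iff_diff_eq_0 f_def)
    then show False using Xne by simp
  qed
  have fxy: "f y * l = - (f x * (1 - l))" using fX unfolding Xl(1) by (simp add: f_def algebra_simps)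
  have fy0: "f y \<noteq> 0" using fxy fx0 l by auto
  \<comment> \<open>The line of \<open>t\<close> separates \<open>x\<close> from \<open>y\<close>,
    so \<open>A\<close> is weakly opposite to one of them, and the corner there can be cut
    off.\<close>
  show ?thesis
  proof (cases "f x * f A \<le> 0")
    case True
    have "tight_triangle x X Y \<and> area x X Y < area x y A"
      by (rule tight_triangle_corner[OF ijk(1,2) t(1) ijk(4) t(2) _ x A(1) Y(1,2) X(2) t(3) Xl(1) l(1,2) uX Y(3) nz])
        (use True Y fx0 in \<open>auto simp: f_def\<close>)
    then show ?thesis by blast
  next
    case False
    have "f y * f A * l = - (f x * f A * (1 - l))" using fxy by (metis mult.commute mult.left_commute mult_minus_left)
    also have "\<dots> < 0" using False l by (simp add: not_le)
    finally have "f y * f A \<le> 0" using l by (auto simp: mult_less_0_iff mult_le_0_iff)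
    have nz': "det2 (x - y) (A - y) \<noteq> 0" using nz by (simp add: det2_def algebra_simps)
    have "tight_triangle y X Z \<and> area y X Z < area y x A"
      by (rule tight_triangle_corner[OF ijk(1,3) t(1) ijk(6) t(2) _ y A(2) Z(1,2) X(2) t(3) Xl(2) _ _ _ Z(3) nz'])
        (use \<open>f y * f A \<le> 0\<close> Z fy0 l uX eq in \<open>auto simp: f_def\<close>)
    then show ?thesis using area_perm by metis
  qed
qed

lemma tight_triangle_imp_K3:
  assumes "tight_triangle x y A"
  shows "has_K3 (seg_verts M) (seg_edges M)"
proof -
  let ?T = "{(x, y, A). tight_triangle x y A}"
  have "?T \<subseteq> crossing_points M \<times> crossing_points M \<times> crossing_points M"
    using triangle_crossing_points by auto
  then have fin: "finite ?T" using finite_crossing_points by (meson finite_SigmaI finite_subset)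
  let ?g = "\<lambda>(x, y, A). area x y A"
  have "?T \<noteq> {}" using assms by auto
  then obtain T where T: "T \<in> ?T" "\<And>T'. T' \<in> ?T \<Longrightarrow> ?g T \<le> ?g T'"
    using finite_obtains_min[OF fin, of ?g] by blast
  obtain a b c where abc: "T = (a, b, c)" by (cases T)
  have tri: "tight_triangle a b c" using T abc by simp
  have min: "\<not> area x' y' A' < area a b c" if "tight_triangle x' y' A'" for x' y' A'
    using T(2)[of "(x', y', A')"] abc that by simp
  have "{a, b} \<in> seg_edges M" using subdivided_side_smaller[OF tri] min by blast
  moreover have "{a, c} \<in> seg_edges M"
    using subdivided_side_smaller[OF tight_triangle_perm(2)[OF tri]] min area_perm by metis
  moreover have "{b, c} \<in> seg_edges M"
    using subdivided_side_smaller[OF tight_triangle_perm(2)[OF tight_triangle_perm(1)[OF tri]]] min area_perm by metis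
  moreover have "a \<noteq> b" "a \<noteq> c" "b \<noteq> c" using tri by (auto simp: tight_triangle_def det2_def)
  moreover have "{a, b, c} \<subseteq> seg_verts M" using triangle_crossing_points[OF tri] by (auto simp: seg_verts_def)
  ultimately show ?thesis unfolding has_K3_def
    by (intro exI[of _ "{a, b, c}"]) (auto simp: insert_commute)
qed

lemma tight_imp_K3:
  assumes i: "i \<in> M" and P: "x \<in> crossing_points M" "y \<in> crossing_points M"
    and xy: "x \<in> i" "y \<in> i" "x \<noteq> y" and eq: "u x = u y"
  shows "has_K3 (seg_verts M) (seg_edges M)"
proof -
  obtain j where j: "j \<in> M" "j \<noteq> i" "x \<in> j" using crossing_point_other[OF P(1)] .
  obtain k where k: "k \<in> M" "k \<noteq> i" "y \<in> k" using crossing_point_other[OF P(2)] .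
  obtain A where A: "A \<in> j" "A \<in> k" "u A = u x" "j \<noteq> k"
    using tight_pair_cross[OF i j(1) k(1) j(2) k(2) xy(1) j(3) xy(2) k(3) xy(3) eq] .
  \<comment> \<open>A degenerate triangle would put \<open>A\<close> on the line of
    \<open>i\<close>, which \<open>j\<close> meets only in \<open>x\<close> and \<open>k\<close>
    only in \<open>y\<close>.\<close>
  have "det2 (y - x) (A - x) \<noteq> 0"
  proof
    assume "det2 (y - x) (A - x) = 0"
    then obtain r where r: "A - x = r *\<^sub>R (y - x)" using det2_eq_0_parallel xy by (metis eq_iff_diff_eq_0)
    then have "A = x + r *\<^sub>R (y - x)" by (simp add: algebra_simps)
    then have "det2 (d i) A = h i" using on_line[OF i] xy by simp
    then have "A = x" "A = y"
      using det2_unique[OF cross_det[OF i j(1) j(2)[symmetric] xy(1) j(3)], of A x] 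
        det2_unique[OF cross_det[OF i k(1) k(2)[symmetric] xy(2) k(3)], of A y] on_line i j k A xy by metis+
    then show False using xy by simp
  qed
  then have "tight_triangle x y A" unfolding tight_triangle_def
    using i j k A xy eq by (intro conjI bexI[of _ i] bexI[of _ j] bexI[of _ k]) auto
  then show ?thesis by (rule tight_triangle_imp_K3)
qed

end

context segment_flow
begin

lemma no_positive_ratio:
  assumes "\<not> has_K3 (seg_verts M) (seg_edges M)" "r \<in> ratios"
  shows "r \<le> 0"
proof (rule ccontr)
  assume r: "\<not> r \<le> 0"
  define R where "R = Max ratios"
  have "R \<in> ratios" using assms finite_ratios R_def Max_in by blast
  have max: "r' \<le> R" if "r' \<in> ratios" for r' using that finite_ratios by (simp add: R_def)
  have "R > 0" using max[OF assms(2)] r by simp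
  interpret segment_flow_max M d h w v R using \<open>R > 0\<close> max by unfold_locales
  obtain s x y where "s \<in> M" "x \<in> crossing_points M" "y \<in> crossing_points M" "x \<in> s" "y \<in> s" "x \<noteq> y"
    "v x - v y = R *\<^sub>R (x - y)" using \<open>R \<in> ratios\<close> by (auto simp: ratios_def)
  moreover from this have "u x = u y" by (simp add: u_def algebra_simps)
  ultimately show False using tight_imp_K3 assms(1) by blast
qed

end


section \<open>Pairs of segments against linear equations\<close>

definition segments_connected :: "point set set \<Rightarrow> bool" where
  "segments_connected M \<longleftrightarrow> (\<forall>A\<subseteq>M. A \<noteq> {} \<longrightarrow> A \<noteq> M \<longrightarrow> (\<exists>a\<in>A. \<exists>b\<in>M - A. a \<inter> b \<noteq> {}))"

definition deg_at :: "point set set \<Rightarrow> point \<Rightarrow> nat" where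
  "deg_at M x = card {s \<in> M. x \<in> s}"

text \<open>A simple crossing counts once, a point of higher degree as often as Euler's formula
  requires: a segment added to a system raises the sum by its number of hits.\<close>

definition excess :: "point set set \<Rightarrow> nat" where
  "excess M = (\<Sum>x\<in>crossing_points M. deg_at M x - 1)"

lemma deg_at_ge_2:
  assumes "finite M" "x \<in> crossing_points M"
  shows "deg_at M x \<ge> 2"
proof -
  obtain s t where st: "s \<in> M" "t \<in> M" "s \<noteq> t" "x \<in> s" "x \<in> t" using assms by (auto simp: crossing_points_def)
  then have "card {s, t} \<le> deg_at M x" unfolding deg_at_def using assms(1) by (intro card_mono) auto
  then show ?thesis using st by simp
qed

context segment_lines
begin

lemma num_points_le_excess: "num_points M \<le> excess M"
proof -
  have "(\<Sum>x\<in>crossing_points M. 1) \<le> excess M" unfolding excess_def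
    by (rule sum_mono) (use deg_at_ge_2[OF finite_M] in fastforce)
  then show ?thesis by (simp add: num_points_def)
qed

definition some_seg :: "point \<Rightarrow> point set" where
  "some_seg x = (SOME s. s \<in> M \<and> x \<in> s)"

lemma some_seg: "x \<in> crossing_points M \<Longrightarrow> some_seg x \<in> M \<and> x \<in> some_seg x"
  unfolding some_seg_def by (rule someI_ex) (auto simp: crossing_points_def)

text \<open>
  Pairs that impose no equation: each crossing point \<open>x\<close> contributes \<open>deg x - 1\<close> of them, since
  concurrency at \<open>x\<close> is enforced by the pairs through \<open>x\<close> that avoid \<open>some_seg x\<close>.
\<close>
definition free_pairs :: "point set set set" where
  "free_pairs = {{some_seg x, j} |x j. x \<in> crossing_points M \<and> j \<in> M \<and> x \<in> j \<and> j \<noteq> some_seg x}"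

definition all_pairs :: "point set set set" where
  "all_pairs = {e. e \<subseteq> M \<and> card e = 2}"

lemma card_all_pairs: "card all_pairs = card M choose 2"
  unfolding all_pairs_def using finite_M by (rule n_subsets)

lemma free_pairs_subset: "free_pairs \<subseteq> all_pairs"
  unfolding free_pairs_def all_pairs_def using some_seg by (auto simp: card_2_iff)

text \<open>Distinct crossing points yield distinct pairs because two segments share at most one
  point.\<close>

lemma card_free_pairs: "card free_pairs = excess M"
proof -
  let ?F = "SIGMA x:crossing_points M. {s \<in> M. x \<in> s} - {some_seg x}"
  let ?g = "\<lambda>(x, j). {some_seg x, j}"
  have "free_pairs = ?g ` ?F" unfolding free_pairs_def by auto
  moreover have "inj_on ?g ?F"
  proof (rule inj_onI)
    fix a b assume a: "a \<in> ?F" and b: "b \<in> ?F" and eq: "?g a = ?g b"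
    obtain x j y k where xy: "a = (x, j)" "b = (y, k)" by (cases a, cases b)
    have j: "x \<in> crossing_points M" "j \<in> M" "x \<in> j" "j \<noteq> some_seg x"
      and k: "y \<in> crossing_points M" "k \<in> M" "y \<in> k" "k \<noteq> some_seg y"
      and e: "{some_seg x, j} = {some_seg y, k}" using a b eq xy by auto
    have "y \<in> some_seg x" "y \<in> j" using e k some_seg[OF k(1)] by (auto simp: doubleton_eq_iff)
    then have "x = y" using meet_unique[of "some_seg x" j x y] j some_seg[OF j(1)] by blast
    then show "a = b" using e xy by (auto simp: doubleton_eq_iff)
  qed
  ultimately have "card free_pairs = card ?F" by (simp add: card_image)
  also have "\<dots> = (\<Sum>x\<in>crossing_points M. card ({s \<in> M. x \<in> s} - {some_seg x}))"
    using finite_crossing_points finite_M by (intro card_SigmaI) auto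
  also have "\<dots> = excess M" unfolding excess_def deg_at_def
    by (rule sum.cong) (use some_seg finite_M in \<open>auto simp: card_Diff_singleton\<close>)
  finally show ?thesis .
qed

definition rigid :: "(point set \<Rightarrow> real) \<Rightarrow> point set \<Rightarrow> point set \<Rightarrow> point set \<Rightarrow> bool" where
  "rigid w i j k \<longleftrightarrow> (\<exists>c. det2 (d i) c = w i \<and> det2 (d j) c = w j \<and> det2 (d k) c = w k)"

text \<open>Three exclusive cases: disjoint on parallel lines, disjoint on crossing lines, crossing.
  In the second case nothing is asked if no segment meets both, as then no triangle needs to be
  controlled.\<close>

definition pair_cond :: "(point set \<Rightarrow> real) \<Rightarrow> point set \<Rightarrow> point set \<Rightarrow> bool" where
  "pair_cond w i j \<longleftrightarrow>
     (i \<inter> j = {} \<and> det2 (d i) (d j) = 0 \<longrightarrow> w i *\<^sub>R d j = w j *\<^sub>R d i)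
   \<and> (i \<inter> j = {} \<and> det2 (d i) (d j) \<noteq> 0 \<and> (\<exists>k\<in>M. k \<inter> i \<noteq> {} \<and> k \<inter> j \<noteq> {})
        \<longrightarrow> (\<exists>k. nearest_rigid w i j k \<or> nearest_rigid w j i k))
   \<and> (\<forall>x\<in>i \<inter> j. rigid w (some_seg x) i j)"

lemma pair_cond_commute: "pair_cond w i j \<longleftrightarrow> pair_cond w j i"
  unfolding pair_cond_def rigid_def using det2_commute[of "d i" "d j"] by (auto simp: Int_commute)

lemma rigid_equation:
  assumes ijk: "i \<in> M" "j \<in> M" "k \<in> M" and det: "det2 (d j) (d k) \<noteq> 0"
  shows "\<exists>c. \<forall>w. (\<Sum>s\<in>M. c s * w s) = 0 \<longrightarrow> rigid w i j k"
proof -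
  \<comment> \<open>Coefficients of the Grassmann-Pluecker relation. Separate indicator terms keep
    the sum correct when \<open>i\<close> coincides with \<open>j\<close> or \<open>k\<close>, as
    happens if \<open>some_seg x\<close> is one of the pair.\<close>
  define c where "c s = (if s = i then det2 (d j) (d k) else 0) - (if s = j then det2 (d i) (d k) else 0)
    + (if s = k then det2 (d i) (d j) else 0)" for s
  have "rigid w i j k" if "(\<Sum>s\<in>M. c s * w s) = 0" for w
  proof -
    have "(\<Sum>s\<in>M. c s * w s) = (\<Sum>s\<in>M. (if s = i then det2 (d j) (d k) * w s else 0))
      - (\<Sum>s\<in>M. (if s = j then det2 (d i) (d k) * w s else 0)) + (\<Sum>s\<in>M. (if s = k then det2 (d i) (d j) * w s else 0))"
      unfolding sum_subtractf[symmetric] sum.distrib[symmetric]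
      by (rule sum.cong) (auto simp: c_def algebra_simps)
    also have "\<dots> = det2 (d j) (d k) * w i - det2 (d i) (d k) * w j + det2 (d i) (d j) * w k"
      using ijk finite_M by simp
    finally have eq: "det2 (d j) (d k) * w i = det2 (d i) (d k) * w j - det2 (d i) (d j) * w k" using that by simp
    obtain p where p: "det2 (d j) p = w j" "det2 (d k) p = w k" using det2_solve[OF det] .
    have "det2 (d i) p * det2 (d j) (d k) = w i * det2 (d j) (d k)"
      using det2_pluecker[of "d i" p "d j" "d k"] eq p by (simp only: mult.commute)
    then have "det2 (d i) p = w i" using det by simp
    then show ?thesis using p unfolding rigid_def by blast
  qed
  then show ?thesis by blast
qed

lemma parallel_equation:
  assumes ij: "i \<in> M" "j \<in> M" and det: "det2 (d i) (d j) = 0"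
  shows "\<exists>c. \<forall>w. (\<Sum>s\<in>M. c s * w s) = 0 \<longrightarrow> w i *\<^sub>R d j = w j *\<^sub>R d i"
proof -
  obtain r where r: "d j = r *\<^sub>R d i" using det2_eq_0_parallel[OF det dir_nz[OF ij(1)]] .
  define c where "c s = (if s = i then r else 0) - (if s = j then 1 else 0)" for s
  have "w i *\<^sub>R d j = w j *\<^sub>R d i" if "(\<Sum>s\<in>M. c s * w s) = 0" for w
  proof -
    have "(\<Sum>s\<in>M. c s * w s) = (\<Sum>s\<in>M. (if s = i then r * w s else 0)) - (\<Sum>s\<in>M. (if s = j then w s else 0))"
      unfolding sum_subtractf[symmetric] by (rule sum.cong) (auto simp: c_def algebra_simps)
    also have "\<dots> = r * w i - w j" using ij finite_M by simp
    finally show ?thesis using that r by (simp add: mult.commute)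
  qed
  then show ?thesis by blast
qed

text \<open>Which segment is nearest depends on positions only, not on \<open>w\<close>; it can be
  fixed beforehand, and a single linear equation remains.\<close>

lemma nearest_equation:
  assumes ij: "i \<in> M" "j \<in> M" and det: "det2 (d i) (d j) \<noteq> 0" and z: "det2 (d i) z = h i" "det2 (d j) z = h j" "z \<notin> j"
    and ex: "k0 \<in> M" "k0 \<inter> i \<noteq> {}" "k0 \<inter> j \<noteq> {}" and dis: "i \<inter> j = {}"
  shows "\<exists>c. \<forall>w. (\<Sum>s\<in>M. c s * w s) = 0 \<longrightarrow> (\<exists>k. nearest_rigid w i j k)"
proof -
  let ?K = "{k \<in> M. k \<inter> i \<noteq> {} \<and> k \<inter> j \<noteq> {}}"
  let ?g = "\<lambda>k. dist z (SOME y. y \<in> k \<inter> j)"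
  have fin: "finite ?K" using finite_M by simp
  have "?K \<noteq> {}" using ex by blast
  then obtain k where k: "k \<in> ?K" "\<And>k'. k' \<in> ?K \<Longrightarrow> ?g k \<le> ?g k'"
    using finite_obtains_min[OF fin, of ?g] by blast
  have some: "(SOME y. y \<in> k' \<inter> j) = y" if "k' \<in> ?K" "y \<in> k' \<inter> j" for k' y
  proof -
    have "k' \<noteq> j" using that dis by auto
    moreover have "(SOME y. y \<in> k' \<inter> j) \<in> k' \<inter> j" using that(2) by (rule someI)
    ultimately show ?thesis using that ij meet_unique by blast
  qed
  have min: "dist z y0 \<le> dist z y" if "k' \<in> M" "k' \<inter> i \<noteq> {}" "y0 \<in> k \<inter> j" "y \<in> k' \<inter> j" for k' y0 y
  proof -
    have k': "k' \<in> ?K" using that by blast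
    have "?g k \<le> ?g k'" using k' by (rule k(2))
    then show ?thesis using some[OF k(1) that(3)] some[OF k' that(4)] by simp
  qed
  obtain c where c: "\<forall>w. (\<Sum>s\<in>M. c s * w s) = 0 \<longrightarrow> rigid w k i j"
    using rigid_equation[OF _ ij det, of k] k by blast
  have zz: "z' = z" if "det2 (d i) z' = h i" "det2 (d j) z' = h j" for z'
    using det2_unique[OF det] that z by metis
  have "nearest_rigid w i j k" if "(\<Sum>s\<in>M. c s * w s) = 0" for w
  proof -
    have "rigid w k i j" using c that by blast
    then show ?thesis unfolding nearest_rigid_def rigid_def using k(1) min zz z(3) by blast
  qed
  then show ?thesis by blast
qed

lemma pair_equation:
  assumes ij: "i \<in> M" "j \<in> M" "i \<noteq> j"
  shows "\<exists>c. \<forall>w. (\<Sum>s\<in>M. c s * w s) = 0 \<longrightarrow> pair_cond w i j"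
proof (cases "i \<inter> j = {}")
  case False
  then obtain x where x: "x \<in> i" "x \<in> j" by blast
  have only: "y = x" if "y \<in> i \<inter> j" for y using meet_unique[OF ij x] that by blast
  have "some_seg x \<in> M" using some_seg crossing_pointI[OF ij x] by blast
  from rigid_equation[OF this ij(1,2) cross_det[OF ij x]] show ?thesis
    unfolding pair_cond_def using False only by blast
next
  case dis: True
  show ?thesis
  proof (cases "det2 (d i) (d j) = 0")
    case True
    from parallel_equation[OF ij(1,2) True] show ?thesis
      unfolding pair_cond_def using True dis by simp
  next
    case False
    then have F': "det2 (d j) (d i) \<noteq> 0" using det2_commute[of "d j" "d i"] by simp
    obtain z where z: "det2 (d i) z = h i" "det2 (d j) z = h j" using det2_solve[OF False] .
    show ?thesis
    proof (cases "\<exists>k\<in>M. k \<inter> i \<noteq> {} \<and> k \<inter> j \<noteq> {}")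
      case True
      then obtain k where k: "k \<in> M" "k \<inter> i \<noteq> {}" "k \<inter> j \<noteq> {}" by blast
      \<comment> \<open>Disjoint segments cannot both contain \<open>z\<close>; distances are
        measured along one that misses it.\<close>
      consider "z \<notin> j" | "z \<notin> i" using dis by blast
      then have "\<exists>c. \<forall>w. (\<Sum>s\<in>M. c s * w s) = 0 \<longrightarrow> (\<exists>k. nearest_rigid w i j k \<or> nearest_rigid w j i k)"
      proof cases
        case 1
        from nearest_equation[OF ij(1,2) False z 1 k dis] show ?thesis by blast
      next
        case 2
        from nearest_equation[OF ij(2,1) F' z(2,1) 2 k(1,3,2)] dis show ?thesis by blast
      qed
      then obtain c where "\<forall>w. (\<Sum>s\<in>M. c s * w s) = 0 \<longrightarrow> (\<exists>k. nearest_rigid w i j k \<or> nearest_rigid w j i k)" ..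
      then show ?thesis unfolding pair_cond_def using dis False by (intro exI[of _ c]) simp
    next
      case no: False
      then show ?thesis unfolding pair_cond_def using dis False by (intro exI) auto
    qed
  qed
qed

text \<open>Free pairs cross, so every disjoint pair has its condition. At a crossing point
  \<open>some_seg x\<close> and one more segment \<open>g\<close> determine the velocity, and any
  further segment \<open>s\<close> follows through the pair \<open>{s, g}\<close>, which is not
  free.\<close>

lemma flow_from_pairs:
  assumes "\<And>i j. \<lbrakk>i \<in> M; j \<in> M; i \<noteq> j; {i, j} \<notin> free_pairs\<rbrakk> \<Longrightarrow> pair_cond w i j"
  obtains v where "segment_flow M d h w v"
proof -
  have miss: "pair_cond w i j" if "i \<in> M" "j \<in> M" "i \<noteq> j" "i \<inter> j = {}" for i j
  proof (rule assms[OF that(1-3)])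
    show "{i, j} \<notin> free_pairs"
    proof
      assume "{i, j} \<in> free_pairs"
      then obtain x k where "x \<in> crossing_points M" "x \<in> k" "{i, j} = {some_seg x, k}"
        by (auto simp: free_pairs_def)
      then have "x \<in> i \<inter> j" using some_seg by (auto simp: doubleton_eq_iff)
      then show False using that by blast
    qed
  qed
  have "\<exists>c. \<forall>s\<in>M. x \<in> s \<longrightarrow> det2 (d s) c = w s" if x: "x \<in> crossing_points M" for x
  proof -
    let ?f = "some_seg x"
    have f: "?f \<in> M" "x \<in> ?f" using some_seg[OF x] by auto
    obtain g where g: "g \<in> M" "g \<noteq> ?f" "x \<in> g" using crossing_point_other[OF x] .
    have det: "det2 (d ?f) (d g) \<noteq> 0" using cross_det f g by metis
    obtain c where c: "det2 (d ?f) c = w ?f" "det2 (d g) c = w g" using det2_solve[OF det] .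
    have "det2 (d s) c = w s" if s: "s \<in> M" "x \<in> s" for s
    proof (cases "s = ?f \<or> s = g")
      case False
      then have ne: "s \<noteq> ?f" "s \<noteq> g" by auto
      have "{s, g} \<notin> free_pairs"
      proof
        assume "{s, g} \<in> free_pairs"
        then obtain y k where y: "y \<in> crossing_points M" "y \<in> k" "{s, g} = {some_seg y, k}"
          by (auto simp: free_pairs_def)
        then have "y \<in> s" "y \<in> g" using some_seg by (auto simp: doubleton_eq_iff)
        then have "y = x" using meet_unique[OF s(1) g(1)] ne s g by metis
        then show False using y ne g by (auto simp: doubleton_eq_iff)
      qed
      then have "rigid w ?f s g" using assms[OF s(1) g(1) ne(2)] s g unfolding pair_cond_def by blast
      then obtain c' where c': "det2 (d ?f) c' = w ?f" "det2 (d s) c' = w s" "det2 (d g) c' = w g"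
        unfolding rigid_def by blast
      have "c' = c" using det2_unique[OF det] c c' by metis
      then show ?thesis using c' by simp
    qed (use c in auto)
    then show ?thesis by blast
  qed
  then obtain v where v: "\<forall>x\<in>crossing_points M. \<forall>s\<in>M. x \<in> s \<longrightarrow> det2 (d s) (v x) = w s" by metis
  have "segment_flow M d h w v"
  proof unfold_locales
    fix s x assume "s \<in> M" "x \<in> crossing_points M" "x \<in> s"
    then show "det2 (d s) (v x) = w s" using v by blast
  next
    fix j k assume *: "j \<in> M" "k \<in> M" "j \<inter> k = {}" "det2 (d j) (d k) = 0"
    show "w j *\<^sub>R d k = w k *\<^sub>R d j"
    proof (cases "j = k")
      case False
      then show ?thesis using miss[OF *(1,2) False *(3)] * unfolding pair_cond_def by blast
    qed simp
  next
    fix j k i assume *: "j \<in> M" "k \<in> M" "j \<inter> k = {}" "det2 (d j) (d k) \<noteq> 0" "i \<in> M" "i \<inter> j \<noteq> {}" "i \<inter> k \<noteq> {}"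
    then have "j \<noteq> k" by auto
    then show "\<exists>i. nearest_rigid w j k i \<or> nearest_rigid w k j i"
      using miss[OF *(1,2) _ *(3)] * unfolding pair_cond_def by blast
  qed
  then show ?thesis using that by blast
qed

end

context segment_flow
begin

text \<open>The reversed motion makes approaching points separate, so a one-sided bound on
  \<open>ratios\<close> yields both signs.\<close>

lemma flow_neg: "segment_flow M d h (\<lambda>s. - w s) (\<lambda>x. - v x)"
proof unfold_locales
  fix s x assume "s \<in> M" "x \<in> crossing_points M" "x \<in> s"
  then show "det2 (d s) (- v x) = - w s" using field by simp
next
  fix j k assume "j \<in> M" "k \<in> M" "j \<inter> k = {}" "det2 (d j) (d k) = 0"
  then show "- w j *\<^sub>R d k = - w k *\<^sub>R d j" using par by simp
next
  have neg: "nearest_rigid (\<lambda>s. - w s) j k i" if n: "nearest_rigid w j k i" for j k i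
  proof -
    obtain c where "det2 (d i) c = w i" "det2 (d j) c = w j" "det2 (d k) c = w k"
      using n unfolding nearest_rigid_def by blast
    then have "\<exists>c. det2 (d i) c = - w i \<and> det2 (d j) c = - w j \<and> det2 (d k) c = - w k"
      by (intro exI[of _ "- c"]) simp
    then show ?thesis using n unfolding nearest_rigid_def by blast
  qed
  fix j k i assume *: "j \<in> M" "k \<in> M" "j \<inter> k = {}" "det2 (d j) (d k) \<noteq> 0" "i \<in> M" "i \<inter> j \<noteq> {}" "i \<inter> k \<noteq> {}"
  show "\<exists>i. nearest_rigid (\<lambda>s. - w s) j k i \<or> nearest_rigid (\<lambda>s. - w s) k j i"
    using mis[OF *] neg by blast
qed

lemma flow_const:
  assumes K3: "\<not> has_K3 (seg_verts M) (seg_edges M)"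
    and "s \<in> M" "x \<in> crossing_points M" "x \<in> s" "y \<in> crossing_points M" "y \<in> s"
  shows "v x = v y"
proof (cases "x = y")
  case False
  obtain r where r: "v x - v y = r *\<^sub>R (x - y)" using flow_ratio assms False by blast
  then have "r \<in> ratios" using assms False by (auto simp: ratios_def)
  then have "r \<le> 0" using no_positive_ratio[OF K3] by blast
  interpret neg: segment_flow M d h "\<lambda>s. - w s" "\<lambda>x. - v x" by (rule flow_neg)
  have "- v x - - v y = (- r) *\<^sub>R (x - y)" using r by (simp add: algebra_simps)
  then have "- r \<in> neg.ratios" using assms False unfolding neg.ratios_def by blast
  then have "- r \<le> 0" using neg.no_positive_ratio[OF K3] by blast
  then show ?thesis using r \<open>r \<le> 0\<close> by simp
qed simp

end

theorem (in segment_lines) excess_bound: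
  assumes K3: "\<not> has_K3 (seg_verts M) (seg_edges M)" and con: "segments_connected M" and m: "card M \<ge> 2"
  shows "excess M + (card M - 2) \<le> card M choose 2"
proof (rule ccontr)
  assume neg: "\<not> ?thesis"
  define E where "E = all_pairs - free_pairs"
  have fin: "finite all_pairs" unfolding all_pairs_def using finite_M by simp
  have "card E + excess M = card M choose 2"
    unfolding E_def card_free_pairs[symmetric] card_all_pairs[symmetric]
    using card_Diff_subset[OF finite_subset[OF free_pairs_subset fin] free_pairs_subset]
      card_mono[OF fin free_pairs_subset] by simp
  then have cE: "card E + 2 < card M" using neg m by simp
  have "M \<noteq> {}" using m by auto
  then obtain i0 where i0: "i0 \<in> M" by blast
  have "{i0} \<noteq> M" using m by auto
  then obtain j0 where j0: "j0 \<in> M" "j0 \<noteq> i0" "i0 \<inter> j0 \<noteq> {}"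
    using con[unfolded segments_connected_def, rule_format, of "{i0}"] i0 by auto
  have "\<forall>e\<in>E. \<exists>c. \<forall>w. (\<Sum>s\<in>M. c s * w s) = 0 \<longrightarrow> (\<forall>i j. e = {i, j} \<longrightarrow> pair_cond w i j)"
  proof
    fix e assume "e \<in> E"
    then obtain i j where ij: "e = {i, j}" "i \<in> M" "j \<in> M" "i \<noteq> j"
      unfolding E_def all_pairs_def by (auto simp: card_2_iff)
    obtain c where c: "\<forall>w. (\<Sum>s\<in>M. c s * w s) = 0 \<longrightarrow> pair_cond w i j" using pair_equation[OF ij(2-4)] by blast
    show "\<exists>c. \<forall>w. (\<Sum>s\<in>M. c s * w s) = 0 \<longrightarrow> (\<forall>i j. e = {i, j} \<longrightarrow> pair_cond w i j)"
      using c pair_cond_commute ij(1) by (intro exI[of _ c]) (auto simp: doubleton_eq_iff)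
  qed
  then obtain c where c: "\<forall>e\<in>E. \<forall>w. (\<Sum>s\<in>M. c e s * w s) = 0 \<longrightarrow> (\<forall>i j. e = {i, j} \<longrightarrow> pair_cond w i j)"
    by metis
  \<comment> \<open>Fixing the lines of \<open>i0\<close> and \<open>j0\<close> removes the translations.\<close>
  define c' where "c' e s = (case e of Inl e \<Rightarrow> c e s | Inr t \<Rightarrow> if s = t then 1 else 0)" for e s
  define E' where "E' = Inl ` E \<union> Inr ` {i0, j0}"
  have finE: "finite E" using fin by (simp add: E_def)
  have "card E' \<le> card (Inl ` E :: (point set set + point set) set) + card (Inr ` {i0, j0} :: (point set set + point set) set)"
    unfolding E'_def by (rule card_Un_le)
  also have "\<dots> \<le> card E + 2" using card_image_le[OF finE, of Inl] card_image_le[of "{i0, j0}" Inr] j0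
    by (intro add_mono) auto
  finally have "card E' < card M" using cE by simp
  moreover have "finite E'" using finE by (simp add: E'_def)
  ultimately obtain w where w: "\<exists>s\<in>M. w s \<noteq> 0" "\<forall>e\<in>E'. (\<Sum>s\<in>M. c' e s * w s) = 0"
    using finite_kernel_nonzero finite_M by blast
  have wz: "w t = 0" if "t \<in> {i0, j0}" for t
  proof -
    have "0 = (\<Sum>s\<in>M. c' (Inr t) s * w s)" using w(2) that by (auto simp: E'_def)
    also have "\<dots> = (\<Sum>s\<in>M. if s = t then w s else 0)" by (rule sum.cong) (auto simp: c'_def)
    also have "\<dots> = w t" using that i0 j0 finite_M by auto
    finally show ?thesis by simp
  qed
  have pc: "pair_cond w i j" if ij: "i \<in> M" "j \<in> M" "i \<noteq> j" "{i, j} \<notin> free_pairs" for i j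
  proof -
    have e: "{i, j} \<in> E" using ij by (auto simp: E_def all_pairs_def)
    then have "(\<Sum>s\<in>M. c' (Inl {i, j}) s * w s) = 0" using w(2) by (auto simp: E'_def)
    then have "(\<Sum>s\<in>M. c {i, j} s * w s) = 0" by (simp add: c'_def)
    then show ?thesis using c e by blast
  qed
  obtain v where "segment_flow M d h w v" using flow_from_pairs[OF pc] .
  then interpret segment_flow M d h w v .
  \<comment> \<open>Being at rest is not enough for the propagation: a second resting segment pins
    one crossing point on \<open>s\<close>, and constancy of \<open>v\<close> along \<open>s\<close>
    then stops everything that \<open>s\<close> meets.\<close>
  define A where "A = {s \<in> M. w s = 0 \<and> (\<exists>t\<in>M. t \<noteq> s \<and> w t = 0 \<and> s \<inter> t \<noteq> {})}"
  have "A = M"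
  proof (rule ccontr)
    assume "A \<noteq> M"
    moreover have "A \<subseteq> M" by (auto simp: A_def)
    moreover have "i0 \<in> A" using i0 j0 wz by (auto simp: A_def)
    ultimately obtain i s where i: "i \<in> A" and s: "s \<in> M" "s \<notin> A" "i \<inter> s \<noteq> {}"
      using con[unfolded segments_connected_def, rule_format, of A] by blast
    obtain j where j: "j \<in> M" "j \<noteq> i" "w j = 0" "i \<inter> j \<noteq> {}" and iM: "i \<in> M" "w i = 0" using i by (auto simp: A_def)
    obtain x y where x: "x \<in> i" "x \<in> j" and y: "y \<in> i" "y \<in> s" using j s by blast
    have ne: "i \<noteq> j" "i \<noteq> s" using j i s by auto
    have P: "x \<in> crossing_points M" "y \<in> crossing_points M"
      using crossing_pointI[OF iM(1) j(1) ne(1) x] crossing_pointI[OF iM(1) s(1) ne(2) y] by auto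
    have "v x = 0"
      using det2_unique[OF cross_det[OF iM(1) j(1) ne(1) x], of "v x" 0] field[OF iM(1) P(1) x(1)] field[OF j(1) P(1) x(2)] iM j by simp
    then have "v y = 0" using flow_const[OF K3 iM(1) P(1) x(1) P(2) y(1)] by simp
    then have "w s = 0" using field[OF s(1) P(2) y(2)] by simp
    then have "s \<in> A" using s iM ne y by (auto simp: A_def)
    then show False using s by blast
  qed
  then show False using w(1) by (auto simp: A_def)
qed

section \<open>The upper bounds\<close>

lemma segment_system_subset: "segment_system M \<Longrightarrow> N \<subseteq> M \<Longrightarrow> segment_system N"
  unfolding segment_system_def by (meson finite_subset subsetD)

lemma segment_systemE:
  assumes "segment_system M" "s \<in> M"
  obtains a b where "a \<noteq> b" "s = closed_segment a b"
  using bspec[OF conjunct1[OF conjunct2[OF assms(1)[unfolded segment_system_def]]] assms(2)] by blast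

lemma finite_seg_verts:
  assumes "segment_system M"
  shows "finite (seg_verts M)"
proof -
  obtain d h where "segment_lines M d h" using segment_system_lines[OF assms] .
  then have "finite (crossing_points M)" by (rule segment_lines.finite_crossing_points)
  moreover have "finite (segment_endpoints M)"
  proof -
    have "finite {a. \<exists>b. s = closed_segment a b}" if s: "s \<in> M" for s
    proof -
      obtain c e where "s = closed_segment c e" using segment_systemE[OF assms s] by blast
      then have "{a. \<exists>b. s = closed_segment a b} \<subseteq> {c, e}" by (auto simp: doubleton_eq_iff)
      then show ?thesis using finite_subset by blast
    qed
    moreover have "segment_endpoints M = (\<Union>s\<in>M. {a. \<exists>b. s = closed_segment a b})"
      by (auto simp: segment_endpoints_def)
    ultimately show ?thesis using assms by (simp add: segment_system_def)
  qed
  ultimately show ?thesis by (simp add: seg_verts_def)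
qed

text \<open>A point that is no vertex lies between two consecutive vertices of its segment, and
  these span an edge. Both exist because the endpoints are vertices.\<close>

lemma segment_covered_by_edges:
  assumes sys: "segment_system M" and s: "s \<in> M" and x: "x \<in> s"
  shows "x \<in> seg_drawing M"
proof (cases "x \<in> seg_verts M")
  case True then show ?thesis by (simp add: seg_drawing_def)
next
  case False
  obtain a b where ab: "a \<noteq> b" "s = closed_segment a b" using segment_systemE[OF sys s] .
  define P where "P t = (1 - t) *\<^sub>R a + t *\<^sub>R b" for t :: real
  have s_eq: "s = P ` {0..1}" unfolding ab(2) closed_segment_image_interval P_def ..
  have inj: "inj P"
  proof (rule injI)
    fix t t' assume "P t = P t'"
    moreover have "P t - P t' = (t - t') *\<^sub>R (b - a)" by (simp add: P_def algebra_simps)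
    ultimately show "t = t'" using ab(1) by (metis eq_iff_diff_eq_0 scaleR_eq_0_iff)
  qed
  obtain tx where tx: "x = P tx" "0 \<le> tx" "tx \<le> 1" using x s_eq by auto
  define U where "U = {t \<in> {0..1}. P t \<in> seg_verts M}"
  have finU: "finite U"
  proof (rule finite_imageD)
    have "P ` U \<subseteq> seg_verts M" by (auto simp: U_def)
    then show "finite (P ` U)" using finite_seg_verts[OF sys] finite_subset by blast
    show "inj_on P U" using inj inj_on_subset by blast
  qed
  have "closed_segment a b \<in> M" "closed_segment b a \<in> M" using s ab by (simp_all add: closed_segment_commute)
  then have "P 0 \<in> seg_verts M" "P 1 \<in> seg_verts M"
    by (auto simp: P_def seg_verts_def segment_endpoints_def)
  then have U01: "0 \<in> U" "1 \<in> U" by (simp_all add: U_def)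
  have "tx \<notin> U" using False tx by (auto simp: U_def)
  then have strict: "0 < tx" "tx < 1" using U01 tx by (metis order_le_imp_less_or_eq)+
  let ?L = "{t \<in> U. t < tx}" and ?G = "{t \<in> U. t > tx}"
  define t1 where "t1 = Max ?L"
  define t2 where "t2 = Min ?G"
  have "?L \<noteq> {}" "?G \<noteq> {}" using U01 strict by auto
  then have t1: "t1 \<in> ?L" and t2: "t2 \<in> ?G"
    using finU unfolding t1_def t2_def by (intro Max_in Min_in; simp)+
  have gap: "\<not> (t1 < t \<and> t < t2)" if t: "t \<in> U" for t
  proof -
    have "t \<noteq> tx" using t \<open>tx \<notin> U\<close> by auto
    then have "t \<in> ?L \<or> t \<in> ?G" using t by auto
    then have "t \<le> t1 \<or> t2 \<le> t" using finU by (auto simp: t1_def t2_def)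
    then show ?thesis by auto
  qed
  have lt: "t1 < tx" "tx < t2" "0 \<le> t1" "t2 \<le> 1" using t1 t2 by (auto simp: U_def)
  have lin: "P ((1 - r) * t1 + r * t2) = (1 - r) *\<^sub>R P t1 + r *\<^sub>R P t2" for r
    by (simp add: P_def algebra_simps)
  have "{P t1, P t2} \<in> seg_edges M" unfolding seg_edges_def mem_Collect_eq
  proof (intro exI conjI)
    show "{P t1, P t2} = {P t1, P t2}" ..
    show "P t1 \<in> seg_verts M" "P t2 \<in> seg_verts M" using t1 t2 by (auto simp: U_def)
    show "P t1 \<noteq> P t2" using inj lt by (auto dest: injD)
    show "\<exists>s\<in>M. P t1 \<in> s \<and> P t2 \<in> s \<and> \<not> (\<exists>x\<in>seg_verts M. x \<in> s \<and> x \<in> open_segment (P t1) (P t2))"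
    proof (intro bexI[OF _ s] conjI notI)
      show "P t1 \<in> s" "P t2 \<in> s" using lt by (auto simp: s_eq)
      assume "\<exists>x\<in>seg_verts M. x \<in> s \<and> x \<in> open_segment (P t1) (P t2)"
      then obtain y where y: "y \<in> seg_verts M" "y \<in> open_segment (P t1) (P t2)" by blast
      then obtain r where r: "0 < r" "r < 1" "y = P ((1 - r) * t1 + r * t2)"
        unfolding lin by (auto simp: in_segment)
      let ?t = "(1 - r) * t1 + r * t2"
      have "?t = t1 + r * (t2 - t1)" "?t = t2 - (1 - r) * (t2 - t1)" by (simp_all add: algebra_simps)
      moreover have "r * (t2 - t1) > 0" "(1 - r) * (t2 - t1) > 0" using r lt by simp_all
      ultimately have "t1 < ?t" "?t < t2" by (metis less_add_same_cancel1, metis diff_less_eq less_add_same_cancel1)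
      moreover from this have "?t \<in> U" using y r lt by (simp add: U_def)
      ultimately show False using gap by blast
    qed
  qed
  moreover have "x \<in> convex hull {P t1, P t2}"
  proof -
    define r where "r = (tx - t1) / (t2 - t1)"
    have r: "0 \<le> r" "r \<le> 1" using lt by (simp_all add: r_def)
    have "r * (t2 - t1) = tx - t1" using lt by (simp add: r_def)
    then have "tx = (1 - r) * t1 + r * t2" by (simp add: algebra_simps)
    then have "x = (1 - r) *\<^sub>R P t1 + r *\<^sub>R P t2" using tx lin by metis
    then have "x \<in> closed_segment (P t1) (P t2)" using r by (auto simp: in_segment)
    then show ?thesis by (simp add: segment_convex_hull)
  qed
  ultimately show ?thesis by (auto simp: seg_drawing_def)
qed

lemma seg_drawing_eq:
  assumes sys: "segment_system M"
  shows "seg_drawing M = \<Union>M"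
proof
  show "\<Union>M \<subseteq> seg_drawing M" using segment_covered_by_edges[OF sys] by blast
  show "seg_drawing M \<subseteq> \<Union>M"
  proof
    fix x assume "x \<in> seg_drawing M"
    then consider "x \<in> crossing_points M" | "x \<in> segment_endpoints M"
      | e where "e \<in> seg_edges M" "x \<in> convex hull e"
      by (auto simp: seg_drawing_def seg_verts_def)
    then show "x \<in> \<Union>M"
    proof cases
      case 1 then show ?thesis by (auto simp: crossing_points_def)
    next
      case 2
      then obtain b where "closed_segment x b \<in> M" by (auto simp: segment_endpoints_def)
      then show ?thesis by (intro UnionI) auto
    next
      case (3 e)
      then obtain u v s where s: "s \<in> M" "u \<in> s" "v \<in> s" "e = {u, v}" by (auto simp: seg_edges_def)
      then have "convex s" using sys by (auto simp: segment_system_def)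
      then have "convex hull e \<subseteq> s" using s by (simp add: hull_minimal)
      then show ?thesis using s 3 by blast
    qed
  qed
qed

lemma compact_Union_segments: "segment_system M \<Longrightarrow> compact (\<Union>M)"
  by (intro compact_Union) (auto simp: segment_system_def)

text \<open>The complement of a bounded plane set has exactly one unbounded component, whence the
  offset 1.\<close>

lemma num_circuits_components:
  assumes sys: "segment_system M" and fin: "finite (components (- \<Union>M))"
  shows "num_circuits M + 1 = card (components (- \<Union>M))"
proof -
  have bd: "bounded (- (- \<Union>M))" using compact_imp_bounded[OF compact_Union_segments[OF sys]] by simp
  have dim: "2 \<le> DIM(point)" by simp
  obtain C where C: "C \<in> components (- \<Union>M)" "\<not> bounded C" using cobounded_unbounded_components[OF bd] by blast
  have "D = C" if "D \<in> components (- \<Union>M)" "\<not> bounded D" for D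
    using cobounded_unique_unbounded_components[OF bd C that dim] .
  then have "circuits M = components (- \<Union>M) - {C}"
    unfolding circuits_def seg_drawing_eq[OF sys] using C by blast
  then show ?thesis unfolding num_circuits_def using C fin
    by (metis One_nat_def Suc_eq_plus1 card_Suc_Diff1)
qed

text \<open>A hit inside or at the end of an old segment creates a point of degree 2, a hit in an
  old crossing point raises its degree by 1: each adds exactly one. This is the hit count of
  \<open>add_segment\<close>.\<close>

lemma excess_insert:
  assumes sys: "segment_system (insert s M)" and s: "s \<notin> M"
  shows "excess (insert s M) = excess M + card (\<Union>M \<inter> s)" "finite (\<Union>M \<inter> s)"
proof -
  obtain d h where "segment_lines (insert s M) d h" using segment_system_lines[OF sys] .
  then interpret L: segment_lines "insert s M" d h .
  let ?Q = "crossing_points (insert s M)"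
  have finM: "finite M" using L.finite_M by simp
  have Q: "?Q = crossing_points M \<union> (\<Union>M \<inter> s)" using s by (auto simp: crossing_points_def)
  have finQ: "finite ?Q" by (rule L.finite_crossing_points)
  then show "finite (\<Union>M \<inter> s)" using Q by simp
  have deg: "deg_at (insert s M) x - 1 = (deg_at M x - 1) + (if x \<in> s then 1 else 0)" if x: "x \<in> ?Q" for x
  proof (cases "x \<in> s")
    case True
    then have "x \<in> \<Union>M" using x Q by (auto simp: crossing_points_def)
    then have pos: "deg_at M x > 0" unfolding deg_at_def using finM by (auto simp: card_gt_0_iff)
    have "{t \<in> insert s M. x \<in> t} = insert s {t \<in> M. x \<in> t}" using True by auto
    then have "deg_at (insert s M) x = deg_at M x + 1" unfolding deg_at_def using finM s by simp
    then show ?thesis using True pos by simp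
  next
    case False
    then have "{t \<in> insert s M. x \<in> t} = {t \<in> M. x \<in> t}" by auto
    then show ?thesis using False by (simp add: deg_at_def)
  qed
  have "excess (insert s M) = (\<Sum>x\<in>?Q. deg_at M x - 1) + (\<Sum>x\<in>?Q. if x \<in> s then 1 else 0)"
    unfolding excess_def sum.distrib[symmetric] by (rule sum.cong[OF refl deg])
  also have "(\<Sum>x\<in>?Q. deg_at M x - 1) = excess M" unfolding excess_def
  proof (rule sum.mono_neutral_right[OF finQ])
    show "crossing_points M \<subseteq> ?Q" using Q by blast
    show "\<forall>x\<in>?Q - crossing_points M. deg_at M x - 1 = 0"
    proof
      fix x assume "x \<in> ?Q - crossing_points M"
      then obtain t where t: "t \<in> M" "x \<in> t" "x \<notin> crossing_points M" using Q by blast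
      then have "{s \<in> M. x \<in> s} = {t}" by (auto simp: crossing_points_def)
      then show "deg_at M x - 1 = 0" by (simp add: deg_at_def)
    qed
  qed
  also have "(\<Sum>x\<in>?Q. if x \<in> s then 1 else 0) = card (?Q \<inter> s)"
    using finQ by (simp add: sum.If_cases Int_def)
  also have "?Q \<inter> s = \<Union>M \<inter> s" using Q by (auto simp: crossing_points_def)
  finally show "excess (insert s M) = excess M + card (\<Union>M \<inter> s)" .
qed

lemma excess_singleton: "excess {s} = 0"
  by (simp add: excess_def crossing_points_def)

text \<open>Euler's formula one segment at a time: connectivity allows an order in which each
  segment meets earlier ones, and h hits give at most h - 1 new components but h more
  \<open>excess\<close>. The loss of one per step is recorded by \<open>k\<close>. The converse
  needs a path connected drawing, hence the condition that \<open>A\<close> is empty.\<close>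

lemma add_connected_segments:
  assumes sys: "segment_system (A \<union> B)" and dis: "\<Union>A \<inter> \<Union>B = {}"
    and con: "segments_connected B" and fin: "finite (components (- \<Union>A))"
    and k: "1 \<le> k" "k \<le> card B"
  shows "\<exists>C\<subseteq>B. card C = k \<and> finite (components (- (\<Union>A \<union> \<Union>C)))
    \<and> card (components (- (\<Union>A \<union> \<Union>C))) + k \<le> card (components (- \<Union>A)) + excess C + 1
    \<and> path_connected (\<Union>C)
    \<and> (A = {} \<longrightarrow> excess C + 2 \<le> card (components (- \<Union>C)) + k)"
  using k
proof (induction k rule: dec_induct)
  have cA: "compact (\<Union>A)" using compact_Union_segments segment_system_subset[OF sys] by blast
  have seg: "\<exists>a b. a \<noteq> b \<and> s = closed_segment a b" if "s \<in> B" for s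
    using segment_systemE[OF sys, of s] that by blast
  {
    case base
    then obtain s where s: "s \<in> B" by (metis One_nat_def all_not_in_conv card.empty not_one_le_zero)
    obtain a b where ab: "a \<noteq> b" "s = closed_segment a b" using seg[OF s] by blast
    have int: "\<Union>A \<inter> closed_segment a b = {}" using dis s ab by blast
    have "finite (components (- (\<Union>A \<union> s)))" "card (components (- (\<Union>A \<union> s))) \<le> card (components (- \<Union>A))"
      using add_segment(1,2)[OF cA fin _ ab(1)] int ab(2) by simp_all
    moreover have "path_connected s" using ab by (simp add: convex_imp_path_connected)
    moreover have "1 \<le> card (components (- s))" if "A = {}"
    proof -
      have "\<not> bounded (- s)" using ab by (metis bounded_Un bounded_closed_segment compl_bot_eq not_bounded_UNIV sup_compl_top)
      then have "- s \<noteq> {}" by auto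
      then have "components (- s) \<noteq> {}" by (simp add: components_eq_empty)
      moreover have "finite (components (- s))" using calculation(1) that \<open>finite (components (- (\<Union>A \<union> s)))\<close> by simp
      ultimately show ?thesis by (metis One_nat_def Suc_leI card_gt_0_iff)
    qed
    ultimately show ?case using s by (intro exI[of _ "{s}"]) (auto simp: excess_singleton)
  next
    case (step k)
    then obtain C where C: "C \<subseteq> B" "card C = k" "finite (components (- (\<Union>A \<union> \<Union>C)))"
      and up: "card (components (- (\<Union>A \<union> \<Union>C))) + k \<le> card (components (- \<Union>A)) + excess C + 1"
      and pc: "path_connected (\<Union>C)" and low: "A = {} \<longrightarrow> excess C + 2 \<le> card (components (- \<Union>C)) + k"
      by auto
    have finB: "finite B" using sys by (simp add: segment_system_def)
    have "C \<noteq> {}" "C \<noteq> B" using C step by auto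
    then obtain c s where cs: "c \<in> C" "s \<in> B - C" "c \<inter> s \<noteq> {}"
      using con[unfolded segments_connected_def, rule_format, OF C(1)] by blast
    obtain a b where ab: "a \<noteq> b" "s = closed_segment a b" using seg[of s] cs(2) by blast
    have sys': "segment_system (insert s C)" by (rule segment_system_subset[OF sys]) (use cs C in blast)
    have sC: "s \<notin> C" using cs by blast
    note ex = excess_insert[OF sys' sC]
    let ?K = "\<Union>A \<union> \<Union>C"
    have cC: "compact (\<Union>C)" by (rule compact_Union_segments, rule segment_system_subset[OF sys']) blast
    have cK: "compact ?K" using cA cC by (rule compact_Un)
    have int: "?K \<inter> s = \<Union>C \<inter> s" using dis cs by blast
    then have fint: "finite (?K \<inter> closed_segment a b)" using ex(2) ab(2) by simp
    have ne: "\<Union>C \<inter> s \<noteq> {}" using cs by blast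
    then have n1: "card (\<Union>C \<inter> s) \<ge> 1" using ex(2) by (simp add: Suc_le_eq card_gt_0_iff)
    note add = add_segment[OF cK C(3) fint ab(1), folded ab(2), unfolded int]
    have eq: "\<Union>A \<union> \<Union>(insert s C) = ?K \<union> s" by blast
    show ?case
    proof (intro exI[of _ "insert s C"] conjI impI)
      show "insert s C \<subseteq> B" using cs C by blast
      show "card (insert s C) = Suc k" using C finB sC by (meson card_insert_disjoint finite_subset)
      show "finite (components (- (\<Union>A \<union> \<Union>(insert s C))))" unfolding eq using add(1) .
      show "card (components (- (\<Union>A \<union> \<Union>(insert s C)))) + Suc k \<le> card (components (- \<Union>A)) + excess (insert s C) + 1"
        unfolding eq ex(1) using add(2) up n1 by linarith
      have "path_connected s" using ab by (simp add: convex_imp_path_connected)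
      then have "path_connected (\<Union>C \<union> s)" using pc ne by (intro path_connected_Un)
      then show "path_connected (\<Union>(insert s C))" by (simp add: Un_commute)
      assume A: "A = {}"
      have "card (components (- \<Union>C)) + card (\<Union>C \<inter> s) \<le> card (components (- (\<Union>C \<union> s))) + 1"
        using add(3) pc ne A by simp
      then show "excess (insert s C) + 2 \<le> card (components (- \<Union>(insert s C))) + Suc k"
        unfolding ex(1) using low A by (simp add: Un_commute)
    qed
  }
qed

lemma add_connected_component:
  assumes sys: "segment_system (A \<union> B)" and dis: "\<Union>A \<inter> \<Union>B = {}"
    and con: "segments_connected B" and fin: "finite (components (- \<Union>A))" and ne: "B \<noteq> {}"
  shows "finite (components (- \<Union>(A \<union> B)))"
    "card (components (- \<Union>(A \<union> B))) + card B \<le> card (components (- \<Union>A)) + excess B + 1"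
    "A = {} \<Longrightarrow> excess B + 2 \<le> card (components (- \<Union>B)) + card B"
proof -
  have finB: "finite B" using sys by (simp add: segment_system_def)
  then have "1 \<le> card B" using ne by (simp add: Suc_le_eq card_gt_0_iff)
  then obtain C where C: "C \<subseteq> B" "card C = card B" and *: "finite (components (- (\<Union>A \<union> \<Union>C)))"
      "card (components (- (\<Union>A \<union> \<Union>C))) + card B \<le> card (components (- \<Union>A)) + excess C + 1"
      "A = {} \<longrightarrow> excess C + 2 \<le> card (components (- \<Union>C)) + card B"
    using add_connected_segments[OF sys dis con fin, of "card B"] by auto
  have "C = B" using C finB by (simp add: card_subset_eq)
  then show "finite (components (- \<Union>(A \<union> B)))"
    "card (components (- \<Union>(A \<union> B))) + card B \<le> card (components (- \<Union>A)) + excess B + 1"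
    "A = {} \<Longrightarrow> excess B + 2 \<le> card (components (- \<Union>B)) + card B"
    using * by (simp_all add: Union_Un_distrib)
qed

section \<open>Reduction to connected systems\<close>

lemma separated_K3_free:
  assumes free: "segment_K3_free M" and sub: "N \<subseteq> M" and sep: "\<Union>N \<inter> \<Union>(M - N) = {}"
  shows "segment_K3_free N"
proof -
  have sys: "segment_system M" and no: "\<not> has_K3 (seg_verts M) (seg_edges M)"
    using free by (auto simp: segment_K3_free_def)
  have V: "seg_verts N \<subseteq> seg_verts M"
    unfolding seg_verts_def crossing_points_def segment_endpoints_def using sub by blast
  \<comment> \<open>Segments outside \<open>N\<close> put no vertex on those of \<open>N\<close>, so
    no edge of the subsystem is subdivided in \<open>M\<close>.\<close>
  have restrict: "x \<in> seg_verts N" if x: "x \<in> seg_verts M" "s \<in> N" "x \<in> s" for x s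
  proof -
    have mem: "t \<in> N" if "t \<in> M" "x \<in> t" for t using that sep \<open>s \<in> N\<close> \<open>x \<in> s\<close> by blast
    show ?thesis
    proof (cases "x \<in> crossing_points M")
      case True
      then show ?thesis using mem unfolding seg_verts_def crossing_points_def by blast
    next
      case False
      then obtain b where "closed_segment x b \<in> M" using x by (auto simp: seg_verts_def segment_endpoints_def)
      then have "closed_segment x b \<in> N" using mem by simp
      then show ?thesis by (auto simp: seg_verts_def segment_endpoints_def)
    qed
  qed
  have E: "seg_edges N \<subseteq> seg_edges M"
  proof
    fix e assume "e \<in> seg_edges N"
    then obtain u v s where e: "e = {u, v}" "u \<in> seg_verts N" "v \<in> seg_verts N" "u \<noteq> v"
      and s: "s \<in> N" "u \<in> s" "v \<in> s" "\<not> (\<exists>x\<in>seg_verts N. x \<in> s \<and> x \<in> open_segment u v)"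
      unfolding seg_edges_def by blast
    have "\<not> (\<exists>x\<in>seg_verts M. x \<in> s \<and> x \<in> open_segment u v)" using s restrict by blast
    moreover have "u \<in> seg_verts M" "v \<in> seg_verts M" "s \<in> M" using e s V sub by auto
    ultimately show "e \<in> seg_edges M" unfolding seg_edges_def mem_Collect_eq
      using e(1,4) s(2,3) by (intro exI[of _ u] exI[of _ v] conjI bexI[of _ s])
  qed
  have "\<not> has_K3 (seg_verts N) (seg_edges N)"
  proof
    assume "has_K3 (seg_verts N) (seg_edges N)"
    then obtain T where T: "T \<subseteq> seg_verts N" "card T = 3" "\<forall>u\<in>T. \<forall>v\<in>T. u \<noteq> v \<longrightarrow> {u, v} \<in> seg_edges N"
      unfolding has_K3_def by blast
    then have "has_K3 (seg_verts M) (seg_edges M)" unfolding has_K3_def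
      using V E by (intro exI[of _ T] conjI) auto
    then show False using no by blast
  qed
  then show ?thesis using segment_system_subset[OF sys sub] by (simp add: segment_K3_free_def)
qed

text \<open>A smallest nonempty part separated from the rest is connected, since a part of it
  without outgoing intersections would be a smaller candidate.\<close>

lemma connected_component_segments:
  assumes "finite M" "M \<noteq> {}"
  obtains B where "B \<subseteq> M" "B \<noteq> {}" "segments_connected B" "\<Union>B \<inter> \<Union>(M - B) = {}"
proof -
  let ?Q = "\<lambda>B. B \<subseteq> M \<and> B \<noteq> {} \<and> \<Union>B \<inter> \<Union>(M - B) = {}"
  have "?Q M" using assms by simp
  then obtain B where B: "?Q B" "\<And>C. ?Q C \<Longrightarrow> card B \<le> card C"
    using ex_has_least_nat[of ?Q M card] by blast
  have "segments_connected B" unfolding segments_connected_def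
  proof (intro allI impI)
    fix A assume A: "A \<subseteq> B" "A \<noteq> {}" "A \<noteq> B"
    show "\<exists>a\<in>A. \<exists>b\<in>B - A. a \<inter> b \<noteq> {}"
    proof (rule ccontr)
      assume no: "\<not> (\<exists>a\<in>A. \<exists>b\<in>B - A. a \<inter> b \<noteq> {})"
      have "\<Union>A \<inter> \<Union>(M - A) = {}"
      proof -
        have "a \<inter> m = {}" if "a \<in> A" "m \<in> M - A" for a m
          using that no B(1) A(1) by (cases "m \<in> B") blast+
        then show ?thesis by blast
      qed
      then have "?Q A" using A B(1) by blast
      then have "card B \<le> card A" by (rule B(2))
      moreover have "finite B" using assms(1) B(1) finite_subset by blast
      ultimately show False using A by (metis card_seteq)
    qed
  qed
  then show ?thesis using that B(1) by blast
qed

lemma choose_2_Suc_Suc: "Suc (Suc k) choose 2 = (k choose 2) + 2 * k + 1"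
  by (simp add: numeral_2_eq_2)

lemma choose_2_superadditive: "(x choose 2) + (y choose 2) \<le> (x + y) choose 2"
proof (induction y)
  case (Suc y)
  have "Suc y choose 2 = (y choose 2) + y" "Suc (x + y) choose 2 = ((x + y) choose 2) + (x + y)"
    by (simp_all add: numeral_2_eq_2)
  then show ?case using Suc by simp
qed simp

lemma choose_2_mono: "x \<le> y \<Longrightarrow> x choose 2 \<le> y choose 2"
  using choose_2_superadditive[of x "y - x"] by simp

lemma K3_free_excess:
  assumes "segment_K3_free M" "segments_connected M" "card M \<ge> 2"
  shows "excess M + (card M - 2) \<le> card M choose 2"
proof -
  obtain d h where "segment_lines M d h" using segment_system_lines assms(1) by (auto simp: segment_K3_free_def)
  then show ?thesis using segment_lines.excess_bound assms by (auto simp: segment_K3_free_def)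
qed

text \<open>Connected parts are split off one by one and contribute additively;
  \<open>choose_2_superadditive\<close> merges the contributions. Truncated subtraction lets a
  single segment contribute 0.\<close>

lemma K3_free_components:
  assumes "segment_K3_free M"
  shows "finite (components (- \<Union>M)) \<and> card (components (- \<Union>M)) \<le> ((card M - 2) choose 2) + 1"
  using assms
proof (induction "card M" arbitrary: M rule: less_induct)
  case less
  have sys: "segment_system M" using less.prems by (simp add: segment_K3_free_def)
  have finM: "finite M" using sys by (simp add: segment_system_def)
  show ?case
  proof (cases "M = {}")
    case True
    have "components (UNIV :: point set) = {UNIV}" by (simp add: components_eq_sing_iff)
    then show ?thesis using True by simp
  next
    case False
    obtain B where B: "B \<subseteq> M" "B \<noteq> {}" "segments_connected B" "\<Union>B \<inter> \<Union>(M - B) = {}"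
      using connected_component_segments[OF finM False] .
    define A where "A = M - B"
    have M_eq: "M = A \<union> B" and AB: "\<Union>A \<inter> \<Union>B = {}" using B by (auto simp: A_def)
    have freeB: "segment_K3_free B" using separated_K3_free[OF less.prems B(1,4)] .
    have "M - A = B" using B by (auto simp: A_def)
    then have freeA: "segment_K3_free A" using separated_K3_free[OF less.prems, of A] AB by (auto simp: A_def)
    have finB: "finite B" using B finM finite_subset by blast
    then have cB: "card B \<ge> 1" using B by (simp add: Suc_le_eq card_gt_0_iff)
    have cM: "card M = card A + card B" using finM B finB
      by (metis A_def add.commute card_Diff_subset card_mono le_add_diff_inverse)
    then have "card A < card M" using cB by simp
    from less.hyps[OF this freeA] have IH: "finite (components (- \<Union>A))" "card (components (- \<Union>A)) \<le> ((card A - 2) choose 2) + 1"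
      by auto
    note add = add_connected_component[OF sys[unfolded M_eq] AB B(3) IH(1) B(2), folded M_eq]
    have "card (components (- \<Union>M)) \<le> ((card A - 2) choose 2) + 1 + ((card B - 2) choose 2)"
    proof (cases "card B = 1")
      case True
      then obtain s where "B = {s}" by (auto simp: card_1_singleton_iff)
      then show ?thesis using add(2) IH(2) by (simp add: excess_singleton)
    next
      case False
      then have "card B \<ge> 2" using cB by simp
      then obtain k where k: "card B = Suc (Suc k)" by (metis Suc_le_D add_2_eq_Suc le_Suc_ex)
      have "excess B + k \<le> Suc (Suc k) choose 2" using K3_free_excess[OF freeB B(3)] k by simp
      \<comment> \<open>Euler's formula subtracts \<open>card B - 1\<close>, that is
        \<open>k + 1\<close>, which leaves just \<open>k choose 2\<close>.\<close>
      then have "excess B \<le> (k choose 2) + k + 1" unfolding choose_2_Suc_Suc by simp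
      then show ?thesis using add(2) IH(2) k by simp
    qed
    also have "\<dots> \<le> ((card A - 2 + (card B - 2)) choose 2) + 1"
      using choose_2_superadditive[of "card A - 2" "card B - 2"] by simp
    also have "\<dots> \<le> ((card M - 2) choose 2) + 1"
      using choose_2_mono[of "card A - 2 + (card B - 2)" "card M - 2"] cM by simp
    finally show ?thesis using add(1) by blast
  qed
qed

text \<open>Pure counting: a cut into a and b segments has a b disjoint pairs, none of them free,
  and a b is at least a + b - 1.\<close>

lemma (in segment_lines) excess_disconnected:
  assumes "\<not> segments_connected M"
  shows "excess M + (card M - 1) \<le> card M choose 2"
proof -
  obtain A where A: "A \<subseteq> M" "A \<noteq> {}" "A \<noteq> M" and no: "\<And>a b. a \<in> A \<Longrightarrow> b \<in> M - A \<Longrightarrow> a \<inter> b = {}"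
    using assms unfolding segments_connected_def by blast
  define X where "X = (\<lambda>(a, b). {a, b}) ` (A \<times> (M - A))"
  have "inj_on (\<lambda>(a, b). {a, b}) (A \<times> (M - A))"
    by (rule inj_onI) (auto simp: doubleton_eq_iff)
  then have cX: "card X = card A * card (M - A)" unfolding X_def by (simp add: card_image card_cartesian_product)
  have finA: "finite A" using A finite_M finite_subset by blast
  have fin: "finite all_pairs" unfolding all_pairs_def using finite_M by simp
  have Xsub: "X \<subseteq> all_pairs" unfolding X_def all_pairs_def using A by (auto simp: card_2_iff)
  have "X \<inter> free_pairs = {}"
  proof -
    have False if e: "e \<in> X" "e \<in> free_pairs" for e
    proof -
      obtain a b where ab: "e = {a, b}" "a \<in> A" "b \<in> M - A" using e(1) by (auto simp: X_def)
      obtain x j where "x \<in> crossing_points M" "x \<in> j" "e = {some_seg x, j}" using e(2) by (auto simp: free_pairs_def)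
      then have "x \<in> a \<inter> b" using some_seg ab by (auto simp: doubleton_eq_iff)
      then show False using no ab by blast
    qed
    then show ?thesis by blast
  qed
  then have "card X + card free_pairs = card (X \<union> free_pairs)"
    using fin Xsub free_pairs_subset by (metis card_Un_disjoint finite_subset)
  also have "\<dots> \<le> card all_pairs" using fin Xsub free_pairs_subset by (intro card_mono) auto
  finally have "card A * card (M - A) + excess M \<le> card M choose 2"
    by (simp add: cX card_free_pairs card_all_pairs)
  moreover have "card M - 1 \<le> card A * card (M - A)"
  proof -
    have a: "card A \<ge> 1" using A finA by (simp add: Suc_le_eq card_gt_0_iff)
    have "M - A \<noteq> {}" using A by blast
    then have b: "card (M - A) \<ge> 1" using finite_M by (simp add: Suc_le_eq card_gt_0_iff)
    have m: "card M = card A + card (M - A)" using A finA finite_M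
      by (simp add: card_Diff_subset card_mono)
    obtain a' b' where "card A = Suc a'" "card (M - A) = Suc b'" using a b by (metis Suc_le_D One_nat_def)
    then show ?thesis using m by simp
  qed
  ultimately show ?thesis by simp
qed

lemma K3_free_num_points:
  assumes "segment_K3_free M"
  shows "int (num_points M) \<le> int (card M choose 2) - (int (card M) - 2)"
proof -
  have sys: "segment_system M" using assms by (simp add: segment_K3_free_def)
  obtain d h where "segment_lines M d h" using segment_system_lines[OF sys] .
  then interpret segment_lines M d h .
  have le: "num_points M \<le> excess M" by (rule num_points_le_excess)
  show ?thesis
  proof (cases "card M \<ge> 2")
    case False
    \<comment> \<open>With fewer than two segments there is no crossing point, and the integer bound
      is 2 or 1.\<close>
    then have "card M = 0 \<or> card M = 1" by auto
    then have "M = {} \<or> (\<exists>s. M = {s})" using finite_M by (auto simp: card_1_singleton_iff)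
    then have "crossing_points M = {}" by (auto simp: crossing_points_def)
    then show ?thesis using False by (simp add: num_points_def)
  next
    case True
    have "excess M + (card M - 2) \<le> card M choose 2"
      using K3_free_excess[OF assms _ True] excess_disconnected by fastforce
    then show ?thesis using le True by linarith
  qed
qed

lemma K3_free_num_circuits:
  assumes "segment_K3_free M"
  shows "num_circuits M \<le> (card M - 2) choose 2"
  using K3_free_components[OF assms] num_circuits_components[of M] assms by (auto simp: segment_K3_free_def)

text \<open>The lower half of Euler's formula; it supplies enough circuits in the extremal
  example.\<close>

lemma connected_num_circuits:
  assumes "segment_system M" "segments_connected M" "M \<noteq> {}"
  shows "num_points M + 1 \<le> num_circuits M + card M"
proof -
  obtain d h where "segment_lines M d h" using segment_system_lines[OF assms(1)] .
  then have "num_points M \<le> excess M" by (rule segment_lines.num_points_le_excess)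
  moreover have "excess M + 2 \<le> card (components (- \<Union>M)) + card M" "finite (components (- \<Union>M))"
    using add_connected_component(1,3)[of "{}" M] assms by simp_all
  ultimately show ?thesis using num_circuits_components[OF assms(1)] by simp
qed

section \<open>Systems attaining both bounds\<close>

definition line_pt :: "real \<Rightarrow> real \<Rightarrow> point" where
  "line_pt t x = vector [x, t * x + t ^ 3]"

text \<open>The factor 4/5 lies between 3/4 and 7/8: on the steeper segment consecutive slopes meet
  at \<open>- (3/4) * t^2\<close>, all other flatter ones at or left of
  \<open>- (7/8) * t^2\<close>. The left end -2 is safe because all crossings have abscissa at least
  -7/4.\<close>

definition slope_seg :: "real \<Rightarrow> point set" where
  "slope_seg t = closed_segment (line_pt t (-2)) (line_pt t (- (4/5) * t\<^sup>2))"

lemma line_pt_nth [simp]: "line_pt t x $ 1 = x" "line_pt t x $ 2 = t * x + t ^ 3"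
  by (simp_all add: line_pt_def)

lemma line_pt_affine: "(1 - r) *\<^sub>R line_pt t x + r *\<^sub>R line_pt t y = line_pt t ((1 - r) * x + r * y)"
  by (simp add: point_eq_iff algebra_simps)

lemma line_pt_between:
  assumes "x < z" "z < y"
  shows "line_pt t z \<in> open_segment (line_pt t x) (line_pt t y)"
proof -
  define r where "r = (z - x) / (y - x)"
  have r: "0 < r" "r < 1" using assms by (simp_all add: r_def)
  have "r * (y - x) = z - x" using assms by (simp add: r_def)
  then have "z = (1 - r) * x + r * y" by (simp add: algebra_simps)
  then have "line_pt t z = (1 - r) *\<^sub>R line_pt t x + r *\<^sub>R line_pt t y" by (simp only: line_pt_affine)
  moreover have "line_pt t x \<noteq> line_pt t y" using assms by (auto simp: point_eq_iff)
  ultimately show ?thesis using r by (auto simp: in_segment)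
qed

lemma slope_seg_iff:
  assumes "\<bar>t\<bar> \<le> 1"
  shows "p \<in> slope_seg t \<longleftrightarrow> p = line_pt t (p$1) \<and> -2 \<le> p$1 \<and> p$1 \<le> - (4/5) * t\<^sup>2" (is "_ \<longleftrightarrow> ?R")
proof -
  have t2: "t\<^sup>2 \<le> 1" using assms by (simp add: abs_square_le_1)
  define e where "e = - (4/5) * t\<^sup>2"
  have e: "-2 < e" using t2 by (simp add: e_def)
  show ?thesis unfolding slope_seg_def e_def[symmetric]
  proof
    assume "p \<in> closed_segment (line_pt t (-2)) (line_pt t e)"
    then obtain r where r: "0 \<le> r" "r \<le> 1" "p = line_pt t ((1 - r) * (-2) + r * e)"
      by (auto simp: in_segment line_pt_affine)
    have x: "p$1 = (1 - r) * (-2) + r * e" using r by simp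
    have "p$1 + 2 = r * (e + 2)" "e - p$1 = (1 - r) * (e + 2)" unfolding x by (simp_all add: algebra_simps)
    moreover have "r * (e + 2) \<ge> 0" "(1 - r) * (e + 2) \<ge> 0" using r e by simp_all
    ultimately have "-2 \<le> p$1" "p$1 \<le> e" by linarith+
    then show "p = line_pt t (p$1) \<and> -2 \<le> p$1 \<and> p$1 \<le> e" using r(3) x by simp
  next
    assume p: "p = line_pt t (p$1) \<and> -2 \<le> p$1 \<and> p$1 \<le> e"
    define r where "r = (p$1 + 2) / (e + 2)"
    have r: "0 \<le> r" "r \<le> 1" using p e by (simp_all add: r_def)
    have "r * (e + 2) = p$1 + 2" using e by (simp add: r_def)
    then have "p$1 = (1 - r) * (-2) + r * e" by (simp add: algebra_simps)
    then have "p = (1 - r) *\<^sub>R line_pt t (-2) + r *\<^sub>R line_pt t e" using p by (simp add: line_pt_affine)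
    then show "p \<in> closed_segment (line_pt t (-2)) (line_pt t e)" using r by (auto simp: in_segment)
  qed
qed

text \<open>Subtracting the two line equations leaves the factor \<open>t - u\<close>; the
  difference of cubes contributes the quadratic form.\<close>

lemma slopes_meet:
  assumes "p = line_pt t (p$1)" "p = line_pt u (p$1)" "t \<noteq> u"
  shows "p$1 = - (t\<^sup>2 + t * u + u\<^sup>2)"
proof -
  have "p$2 = t * p$1 + t ^ 3" "p$2 = u * p$1 + u ^ 3" using assms(1,2) line_pt_nth(2) by metis+
  then have "(t - u) * (p$1 + (t\<^sup>2 + t * u + u\<^sup>2)) = 0" by (simp add: algebra_simps power2_eq_square power3_eq_cube)
  then show ?thesis using assms(3) by simp
qed

text \<open>The value \<open>0\<close> for \<open>k > n\<close> makes \<open>k = n + 1\<close> the index of the horizontal segment.\<close>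
definition slope :: "nat \<Rightarrow> nat \<Rightarrow> real" where
  "slope n k = (if k \<le> n then (- 1 / 2) ^ k else 0)"

definition example :: "nat \<Rightarrow> point set set" where
  "example n = (\<lambda>k. slope_seg (slope n k)) ` {..n + 1}"

lemma slope_abs_le_1: "\<bar>slope n k\<bar> \<le> 1"
  by (simp add: slope_def power_abs power_le_one)

lemma slope_nz: "k \<le> n \<Longrightarrow> slope n k \<noteq> 0"
  by (simp add: slope_def)

lemma slope_half:
  assumes "a < k"
  shows "2 * \<bar>slope n k\<bar> \<le> \<bar>slope n a\<bar>"
proof (cases "k \<le> n")
  case True
  have "(1 / 2 :: real) ^ k \<le> (1 / 2) ^ Suc a" using assms by (intro power_decreasing) auto
  then show ?thesis using True assms by (simp add: slope_def power_abs)
qed (simp add: slope_def)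

lemma slope_adjacent: "Suc a \<le> n \<Longrightarrow> slope n (Suc a) = - slope n a / 2"
  by (simp add: slope_def)

lemma slope_distinct:
  assumes "a < k" "k \<le> n + 1"
  shows "slope n a \<noteq> slope n k"
  using slope_half[OF assms(1), of n] slope_nz[of a n] assms by auto

definition adjacent :: "nat \<Rightarrow> nat \<Rightarrow> nat \<Rightarrow> bool" where
  "adjacent n a k \<longleftrightarrow> k = Suc a \<and> k \<le> n"

text \<open>The product is \<open>(slope n a)^2\<close> times a power of -1/2 with the index gap as
  exponent: positive for gap 2, at most 1/8 in size beyond. Only gap 1, with factor -1/2, would
  break the bound; the horizontal segment gives 0.\<close>

lemma slope_product_lower:
  assumes "a < k" "k \<le> n + 1" "\<not> adjacent n a k"
  shows "slope n a * slope n k \<ge> - (slope n a)\<^sup>2 / 8"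
proof (cases "k \<le> n")
  case False then show ?thesis by (simp add: slope_def)
next
  case True
  define i where "i = k - a"
  have i: "k = a + i" "i \<ge> 2" using assms True by (auto simp: i_def adjacent_def)
  define q where "q = (- 1 / 2 :: real) ^ i"
  have q: "q \<ge> - 1 / 8"
  proof (cases "i = 2")
    case False
    have "(1 / 2 :: real) ^ i \<le> (1 / 2) ^ 3" using i False by (intro power_decreasing) auto
    then have "\<bar>q\<bar> \<le> (1 / 2) ^ 3" by (simp add: q_def power_abs)
    then show ?thesis by (simp add: power3_eq_cube)
  qed (simp add: q_def power2_eq_square)
  have "slope n a * slope n k = (slope n a)\<^sup>2 * q"
    using True i by (simp add: slope_def q_def power_add power2_eq_square)
  moreover have "(slope n a)\<^sup>2 * q \<ge> (slope n a)\<^sup>2 * (- 1 / 8)" using q by (intro mult_left_mono) auto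
  ultimately show ?thesis by simp
qed

section \<open>Order of the crossings along a segment\<close>

definition cross_x :: "nat \<Rightarrow> nat \<Rightarrow> nat \<Rightarrow> real" where
  "cross_x n a k = - ((slope n a)\<^sup>2 + slope n a * slope n k + (slope n k)\<^sup>2)"

definition cross_pt :: "nat \<Rightarrow> nat \<Rightarrow> nat \<Rightarrow> point" where
  "cross_pt n a k = line_pt (slope n a) (cross_x n a k)"

lemma cross_pt_alt: "cross_pt n a k = line_pt (slope n k) (cross_x n a k)"
  by (simp add: cross_pt_def cross_x_def point_eq_iff algebra_simps power2_eq_square power3_eq_cube)

abbreviation ex_seg :: "nat \<Rightarrow> nat \<Rightarrow> point set" where
  "ex_seg n k \<equiv> slope_seg (slope n k)"

lemma ex_seg_meet:
  assumes "a < k" "k \<le> n + 1" "p \<in> ex_seg n a" "p \<in> ex_seg n k"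
  shows "p = cross_pt n a k" "\<not> adjacent n a k"
proof -
  let ?t = "slope n a" and ?u = "slope n k"
  have p: "p = line_pt ?t (p$1)" "p$1 \<le> - (4/5) * ?t\<^sup>2" "p = line_pt ?u (p$1)"
    using assms(3,4) slope_seg_iff[OF slope_abs_le_1] by blast+
  have x: "p$1 = cross_x n a k" unfolding cross_x_def using slopes_meet[OF p(1,3) slope_distinct[OF assms(1,2)]] .
  then show "p = cross_pt n a k" using p(1) by (simp add: cross_pt_def)
  show "\<not> adjacent n a k"
  proof
    assume ad: "adjacent n a k"
    then have u: "?u = - ?t / 2" using slope_adjacent by (auto simp: adjacent_def)
    \<comment> \<open>Lines of adjacent slopes meet to the right of the cut at
      \<open>- (4/5) * t^2\<close>.\<close>
    have "cross_x n a k = - (3/4) * ?t\<^sup>2" unfolding cross_x_def u by (simp add: power2_eq_square)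
    moreover have "?t\<^sup>2 > 0" using slope_nz ad by (simp add: adjacent_def)
    ultimately show False using p(2) x by simp
  qed
qed

lemma slope_square_bounds:
  assumes "a < k"
  shows "4 * (slope n k)\<^sup>2 \<le> (slope n a)\<^sup>2" "2 * \<bar>slope n a * slope n k\<bar> \<le> (slope n a)\<^sup>2"
proof -
  have h: "2 * \<bar>slope n k\<bar> \<le> \<bar>slope n a\<bar>" by (rule slope_half[OF assms])
  then have "(2 * \<bar>slope n k\<bar>)\<^sup>2 \<le> \<bar>slope n a\<bar>\<^sup>2" by (intro power_mono) auto
  then show "4 * (slope n k)\<^sup>2 \<le> (slope n a)\<^sup>2" by (simp add: power_mult_distrib)
  have "\<bar>slope n a\<bar> * (2 * \<bar>slope n k\<bar>) \<le> \<bar>slope n a\<bar> * \<bar>slope n a\<bar>" using h by (intro mult_left_mono) auto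
  then show "2 * \<bar>slope n a * slope n k\<bar> \<le> (slope n a)\<^sup>2" by (simp add: abs_mult power2_eq_square algebra_simps)
qed

lemma cross_pt_mem:
  assumes "a < k" "k \<le> n + 1" "\<not> adjacent n a k"
  shows "cross_pt n a k \<in> ex_seg n a" "cross_pt n a k \<in> ex_seg n k"
proof -
  let ?t = "slope n a" and ?u = "slope n k"
  note b = slope_square_bounds[OF assms(1), of n]
  note l = slope_product_lower[OF assms]
  have t2: "?t\<^sup>2 \<le> 1" using slope_abs_le_1 by (simp add: abs_square_le_1)
  have u2: "0 \<le> ?u\<^sup>2" "0 \<le> ?t\<^sup>2" by simp_all
  have prod: "?t * ?u \<le> \<bar>?t * ?u\<bar>" "- (?t * ?u) \<le> \<bar>?t * ?u\<bar>" by simp_all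
  have x: "-2 \<le> cross_x n a k" "cross_x n a k \<le> - (4/5) * ?t\<^sup>2" "cross_x n a k \<le> - (4/5) * ?u\<^sup>2"
    unfolding cross_x_def using b l t2 u2 prod by linarith+
  have "cross_pt n a k $ 1 = cross_x n a k" by (simp add: cross_pt_def)
  then show "cross_pt n a k \<in> ex_seg n a" "cross_pt n a k \<in> ex_seg n k"
    unfolding slope_seg_iff[OF slope_abs_le_1] using x cross_pt_def[of n a k] cross_pt_alt[of n a k] by auto
qed

text \<open>Halving makes the leading square dominate: \<open>t^2 + t * u\<close> is at least 3/4 of
  \<open>t^2\<close>, while \<open>v^2 + v * u\<close> is at most 3/8 of it. The resulting order on
  segment \<open>c\<close> excludes triple points and shows which sides are subdivided.\<close>

lemma cross_x_mono:
  assumes "a < b" "b < c" "c \<le> n + 1"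
  shows "cross_x n a c < cross_x n b c"
proof -
  let ?t = "slope n a" and ?v = "slope n b" and ?u = "slope n c"
  have ac: "a < c" using assms by simp
  have "2 * \<bar>?u\<bar> \<le> \<bar>?v\<bar>" "2 * \<bar>?v\<bar> \<le> \<bar>?t\<bar>" using slope_half assms by blast+
  then have "4 * \<bar>?u\<bar> \<le> \<bar>?t\<bar>" by simp
  then have "\<bar>?t\<bar> * (4 * \<bar>?u\<bar>) \<le> \<bar>?t\<bar> * \<bar>?t\<bar>" by (intro mult_left_mono) auto
  then have tu: "4 * \<bar>?t * ?u\<bar> \<le> ?t\<^sup>2" by (simp add: abs_mult power2_eq_square algebra_simps)
  have tv: "4 * ?v\<^sup>2 \<le> ?t\<^sup>2" by (rule slope_square_bounds(1)[OF assms(1)])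
  have vu: "2 * \<bar>?v * ?u\<bar> \<le> ?v\<^sup>2" by (rule slope_square_bounds(2)[OF assms(2)])
  have "?t\<^sup>2 > 0" using slope_nz[of a n] assms by simp
  moreover have "- (?t * ?u) \<le> \<bar>?t * ?u\<bar>" "?v * ?u \<le> \<bar>?v * ?u\<bar>" by simp_all
  ultimately show ?thesis unfolding cross_x_def using tu tv vu by linarith
qed

lemma ex_seg_no_three:
  assumes "a < b" "b < c" "c \<le> n + 1" "p \<in> ex_seg n a" "p \<in> ex_seg n b" "p \<in> ex_seg n c"
  shows False
proof -
  have "p = cross_pt n a c" "p = cross_pt n b c" using ex_seg_meet(1) assms by (meson less_trans)+
  then have "cross_x n a c = cross_x n b c" unfolding cross_pt_def by (metis line_pt_nth(1))
  then show False using cross_x_mono[OF assms(1-3)] by simp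
qed

lemma ex_seg_ends:
  obtains p q where "p \<in> ex_seg n k" "q \<in> ex_seg n k" "p \<noteq> q" "p$1 < q$1"
    "p = line_pt (slope n k) (p$1)" "q = line_pt (slope n k) (q$1)" "ex_seg n k = closed_segment p q"
proof -
  let ?t = "slope n k"
  have "?t\<^sup>2 \<le> 1" using slope_abs_le_1 by (simp add: abs_square_le_1)
  then have "-2 < - (4/5) * ?t\<^sup>2" by simp
  then show ?thesis using that[of "line_pt ?t (-2)" "line_pt ?t (- (4/5) * ?t\<^sup>2)"]
    by (auto simp: slope_seg_def point_eq_iff)
qed

lemma ex_seg_meet_unique:
  assumes "a \<noteq> k" "a \<le> n + 1" "k \<le> n + 1" "p \<in> ex_seg n a" "p \<in> ex_seg n k" "q \<in> ex_seg n a" "q \<in> ex_seg n k"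
  shows "p = q"
  using assms ex_seg_meet(1) by (metis linorder_neqE_nat)

lemma ex_seg_inj: "inj_on (ex_seg n) {..n + 1}"
proof (rule inj_onI)
  fix a k assume ak: "a \<in> {..n + 1}" "k \<in> {..n + 1}" "ex_seg n a = ex_seg n k"
  obtain p q where "p \<in> ex_seg n a" "q \<in> ex_seg n a" "p \<noteq> q" by (rule ex_seg_ends)
  then show "a = k" using ex_seg_meet_unique[of a k n p q] ak by auto
qed

lemma card_example: "card (example n) = n + 2"
  unfolding example_def using ex_seg_inj by (simp add: card_image)

lemma ex_seg_not_collinear:
  assumes "a \<noteq> k" "a \<le> n + 1" "k \<le> n + 1"
  shows "\<not> collinear (ex_seg n a \<union> ex_seg n k)"
proof
  assume "collinear (ex_seg n a \<union> ex_seg n k)"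
  then obtain u where u: "\<And>x y. x \<in> ex_seg n a \<union> ex_seg n k \<Longrightarrow> y \<in> ex_seg n a \<union> ex_seg n k \<Longrightarrow> \<exists>c. x - y = c *\<^sub>R u"
    unfolding collinear_def by blast
  have sl: "u$1 \<noteq> 0 \<and> u$2 = slope n j * u$1" if j: "j = a \<or> j = k" for j
  proof -
    obtain p q where pq: "p \<in> ex_seg n j" "q \<in> ex_seg n j" "p$1 < q$1"
      "p = line_pt (slope n j) (p$1)" "q = line_pt (slope n j) (q$1)" by (rule ex_seg_ends)
    obtain c where c: "q - p = c *\<^sub>R u" using u[of q p] pq j by blast
    have c1: "q$1 - p$1 = c * u$1" using c by (metis vector_minus_component vector_scaleR_component real_scaleR_def)
    have c2: "q$2 - p$2 = c * u$2" using c by (metis vector_minus_component vector_scaleR_component real_scaleR_def)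
    have "q$2 = slope n j * q$1 + slope n j ^ 3" "p$2 = slope n j * p$1 + slope n j ^ 3"
      using pq(4,5) line_pt_nth(2) by metis+
    then have "q$2 - p$2 = slope n j * (q$1 - p$1)" by (simp add: algebra_simps)
    then have "c * u$2 = c * (slope n j * u$1)" using c1 c2 by simp
    moreover have "c \<noteq> 0" "u$1 \<noteq> 0" using c1 pq(3) by auto
    ultimately show ?thesis by simp
  qed
  have "slope n a = slope n k" using sl[of a] sl[of k] by auto
  then show False using slope_distinct assms by (metis linorder_neqE_nat)
qed

lemma example_system: "segment_system (example n)"
  unfolding segment_system_def
proof (intro conjI ballI impI)
  show "finite (example n)" by (simp add: example_def)
  fix s assume "s \<in> example n"
  then obtain k where "s = ex_seg n k" by (auto simp: example_def)
  then show "\<exists>a b. a \<noteq> b \<and> s = closed_segment a b" using ex_seg_ends[of n k] by metis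
next
  fix s t assume st: "s \<in> example n" "t \<in> example n" "s \<noteq> t" "collinear (s \<union> t)"
  then obtain a k where "s = ex_seg n a" "t = ex_seg n k" "a \<le> n + 1" "k \<le> n + 1" by (auto simp: example_def)
  then have False using ex_seg_not_collinear st by metis
  then show "s \<inter> t = {}" ..
qed

text \<open>On segment \<open>c\<close> the crossing with segment \<open>Suc a\<close> lies strictly between those with \<open>a\<close> and \<open>b\<close>.\<close>
lemma example_not_edge:
  assumes ab: "a < b" "b < c" "c \<le> n + 1" and meet: "z \<in> ex_seg n a" "z \<in> ex_seg n b"
    and p: "p \<in> ex_seg n a" "p \<in> ex_seg n c" and q: "q \<in> ex_seg n b" "q \<in> ex_seg n c"
  shows "{p, q} \<notin> seg_edges (example n)"
proof
  assume "{p, q} \<in> seg_edges (example n)"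
  then obtain u v s where uv: "{p, q} = {u, v}" and s: "s \<in> example n" "u \<in> s" "v \<in> s"
    and no: "\<not> (\<exists>x\<in>seg_verts (example n). x \<in> s \<and> x \<in> open_segment u v)"
    unfolding seg_edges_def by blast
  have pq_s: "p \<in> s" "q \<in> s" and seg: "open_segment u v = open_segment p q"
    using uv s by (auto simp: doubleton_eq_iff open_segment_commute)
  have pe: "p = line_pt (slope n c) (cross_x n a c)" and qe: "q = line_pt (slope n c) (cross_x n b c)"
    using ex_seg_meet(1)[of a c n p] ex_seg_meet(1)[of b c n q] ab p q by (auto simp: cross_pt_alt)
  have "cross_x n a c < cross_x n b c" using cross_x_mono ab by blast
  then have "p \<noteq> q" using pe qe line_pt_nth(1) by (metis less_irrefl)
  obtain j where j: "s = ex_seg n j" "j \<le> n + 1" using s by (auto simp: example_def)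
  have "j = c" using ex_seg_meet_unique[of j c n p q] j pq_s p q ab \<open>p \<noteq> q\<close> by auto
  have nad: "\<not> adjacent n a b" using ex_seg_meet(2)[OF ab(1) _ meet] ab by simp
  \<comment> \<open>As \<open>b < c \<le> n + 1\<close> gives \<open>b \<le> n\<close>,
    non-adjacency means that \<open>b\<close> is not \<open>Suc a\<close>.\<close>
  then have b: "Suc a < b" using ab by (auto simp: adjacent_def)
  have "\<not> adjacent n (Suc a) c" using b ab by (auto simp: adjacent_def)
  then have w: "cross_pt n (Suc a) c \<in> ex_seg n (Suc a)" "cross_pt n (Suc a) c \<in> ex_seg n c"
    using cross_pt_mem[of "Suc a" c n] b ab by auto
  have "ex_seg n (Suc a) \<noteq> ex_seg n c" using inj_on_eq_iff[OF ex_seg_inj[of n], of "Suc a" c] b ab by simp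
  moreover have "ex_seg n (Suc a) \<in> example n" "ex_seg n c \<in> example n" unfolding example_def using b ab by auto
  ultimately have "cross_pt n (Suc a) c \<in> crossing_points (example n)"
    unfolding crossing_points_def using w by blast
  moreover have "cross_pt n (Suc a) c \<in> open_segment p q"
    unfolding pe qe cross_pt_alt using cross_x_mono[of a "Suc a" c n] cross_x_mono[of "Suc a" b c n] b ab
    by (intro line_pt_between) auto
  ultimately show False using no seg w(2) j(1) \<open>j = c\<close> by (auto simp: seg_verts_def)
qed

lemma example_not_edge_sym:
  assumes "a \<noteq> b" "a < c" "b < c" "c \<le> n + 1" "z \<in> ex_seg n a" "z \<in> ex_seg n b"
    "p \<in> ex_seg n a" "p \<in> ex_seg n c" "q \<in> ex_seg n b" "q \<in> ex_seg n c"
  shows "{p, q} \<notin> seg_edges (example n)"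
proof (cases "a < b")
  case True then show ?thesis using example_not_edge assms by blast
next
  case False
  then have "{q, p} \<notin> seg_edges (example n)" using example_not_edge[of b a c n z q p] assms by auto
  then show ?thesis by (simp add: insert_commute)
qed

lemma edge_segment:
  assumes "{p, q} \<in> seg_edges (example n)" "p \<noteq> q"
  obtains k where "k \<le> n + 1" "p \<in> ex_seg n k" "q \<in> ex_seg n k"
    "\<forall>x\<in>seg_verts (example n). x \<in> ex_seg n k \<longrightarrow> x \<notin> open_segment p q"
proof -
  obtain u v s where uv: "{p, q} = {u, v}" and s: "s \<in> example n" "u \<in> s" "v \<in> s"
    and no: "\<not> (\<exists>x\<in>seg_verts (example n). x \<in> s \<and> x \<in> open_segment u v)"
    using assms(1) unfolding seg_edges_def by blast
  have "p \<in> s" "q \<in> s" and seg: "open_segment u v = open_segment p q"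
    using uv s by (auto simp: doubleton_eq_iff open_segment_commute)
  moreover obtain k where "s = ex_seg n k" "k \<le> n + 1" using s by (auto simp: example_def)
  ultimately show ?thesis using that no by blast
qed

lemma three_on_segment:
  fixes x y z :: point
  assumes "x \<in> closed_segment a b" "y \<in> closed_segment a b" "z \<in> closed_segment a b" "x \<noteq> y" "y \<noteq> z" "x \<noteq> z"
  shows "x \<in> open_segment y z \<or> y \<in> open_segment x z \<or> z \<in> open_segment x y"
proof -
  have "collinear (closed_segment a b)" by (rule collinear_closed_segment)
  then have "collinear {x, y, z}" by (rule collinear_subset) (use assms in auto)
  then show ?thesis using assms by (auto simp: collinear_between_cases between_mem_segment open_segment_def closed_segment_commute)
qed

lemma example_K3_free: "segment_K3_free (example n)"
proof -
  have "\<not> has_K3 (seg_verts (example n)) (seg_edges (example n))"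
  proof
    assume "has_K3 (seg_verts (example n)) (seg_edges (example n))"
    then obtain T where T: "T \<subseteq> seg_verts (example n)" "card T = 3"
      "\<And>u v. u \<in> T \<Longrightarrow> v \<in> T \<Longrightarrow> u \<noteq> v \<Longrightarrow> {u, v} \<in> seg_edges (example n)"
      unfolding has_K3_def by blast
    obtain x y z where xyz: "T = {x, y, z}" "x \<noteq> y" "y \<noteq> z" "x \<noteq> z" using T(2) by (auto simp: card_3_iff)
    have V: "x \<in> seg_verts (example n)" "y \<in> seg_verts (example n)" "z \<in> seg_verts (example n)" using T xyz by auto
    have E: "{x, y} \<in> seg_edges (example n)" "{x, z} \<in> seg_edges (example n)" "{y, z} \<in> seg_edges (example n)"
      using T(3) xyz by auto
    obtain i where i: "i \<le> n + 1" "x \<in> ex_seg n i" "y \<in> ex_seg n i"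
      "\<forall>p\<in>seg_verts (example n). p \<in> ex_seg n i \<longrightarrow> p \<notin> open_segment x y"
      using edge_segment[OF E(1) xyz(2)] .
    obtain j where j: "j \<le> n + 1" "x \<in> ex_seg n j" "z \<in> ex_seg n j"
      "\<forall>p\<in>seg_verts (example n). p \<in> ex_seg n j \<longrightarrow> p \<notin> open_segment x z"
      using edge_segment[OF E(2) xyz(4)] .
    obtain k where k: "k \<le> n + 1" "y \<in> ex_seg n k" "z \<in> ex_seg n k"
      "\<forall>p\<in>seg_verts (example n). p \<in> ex_seg n k \<longrightarrow> p \<notin> open_segment y z"
      using edge_segment[OF E(3) xyz(3)] .
    \<comment> \<open>Of three points on one segment one lies between the others, so they are not
      pairwise joined by edges. With unique intersections, the sides must come from three different
      segments.\<close>
    have "\<not> (i = j \<and> j = k)"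
    proof
      assume *: "i = j \<and> j = k"
      obtain a b where "ex_seg n i = closed_segment a b" by (meson ex_seg_ends)
      then have "x \<in> open_segment y z \<or> y \<in> open_segment x z \<or> z \<in> open_segment x y"
        using three_on_segment xyz(2-4) i(2,3) j(3) * by blast
      then show False using i j k V * by blast
    qed
    moreover have "i = j \<Longrightarrow> i = k" using ex_seg_meet_unique[of i k n y z] i j k xyz by auto
    moreover have "i = k \<Longrightarrow> i = j" using ex_seg_meet_unique[of i j n x z] i j k xyz by auto
    moreover have "j = k \<Longrightarrow> i = j" using ex_seg_meet_unique[of i j n x y] i j k xyz by auto
    ultimately have ne: "i \<noteq> j" "j \<noteq> k" "i \<noteq> k" by metis+
    \<comment> \<open>The segment of largest index carries the side that is subdivided.\<close>
    then consider "i < k" "j < k" | "i < j" "k < j" | "j < i" "k < i" by linarith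
    then show False
    proof cases
      case 1 then show False using example_not_edge_sym[of i j k n x y z] ne i j k E by blast
    next
      case 2 then show False using example_not_edge_sym[of i k j n y x z] ne i j k E by blast
    next
      case 3 then show False using example_not_edge_sym[of j k i n z x y] ne i j k E by blast
    qed
  qed
  then show ?thesis using example_system by (simp add: segment_K3_free_def)
qed

lemma ex_seg_meets_last:
  assumes "a \<le> n"
  shows "ex_seg n a \<inter> ex_seg n (n + 1) \<noteq> {}"
  using cross_pt_mem[of a "n + 1" n] assms by (auto simp: adjacent_def)

text \<open>The horizontal segment meets all others, so some intersection crosses every cut.\<close>

lemma example_connected: "segments_connected (example n)"
  unfolding segments_connected_def
proof (intro allI impI)
  fix A assume A: "A \<subseteq> example n" "A \<noteq> {}" "A \<noteq> example n"
  let ?l = "ex_seg n (n + 1)"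
  have l: "?l \<in> example n" by (simp add: example_def)
  have meets: "s \<inter> ?l \<noteq> {}" if s: "s \<in> example n" "s \<noteq> ?l" for s
  proof -
    obtain k where k: "s = ex_seg n k" "k \<le> n + 1" using s by (auto simp: example_def)
    then have "k \<le> n" using s(2) by (cases "k = n + 1") auto
    then show ?thesis using ex_seg_meets_last k(1) by blast
  qed
  show "\<exists>a\<in>A. \<exists>b\<in>example n - A. a \<inter> b \<noteq> {}"
  proof (cases "?l \<in> A")
    case True
    obtain b where b: "b \<in> example n - A" using A by blast
    then have "b \<inter> ?l \<noteq> {}" using meets True by blast
    then show ?thesis using b True by blast
  next
    case False
    obtain a where a: "a \<in> A" using A by blast
    then have "a \<inter> ?l \<noteq> {}" using meets A False by blast
    then show ?thesis using a l False by blast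
  qed
qed

text \<open>Larger index in front. Exactly the \<open>n\<close> adjacent pairs are removed; the pair
  of \<open>n + 1\<close> and \<open>n\<close> stays, since the horizontal segment misses
  nothing.\<close>

definition crossing_pairs :: "nat \<Rightarrow> (nat \<times> nat) set" where
  "crossing_pairs n = (SIGMA k:{..<n + 2}. {..<k}) - (\<lambda>a. (Suc a, a)) ` {..<n}"

lemma sum_lessThan_choose_2: "(\<Sum>k<m. k) = m choose 2"
  by (induction m) (simp_all add: numeral_2_eq_2)

lemma card_crossing_pairs: "card (crossing_pairs n) = ((n + 2) choose 2) - n"
proof -
  have "(\<lambda>a. (Suc a, a)) ` {..<n} \<subseteq> (SIGMA k:{..<n + 2}. {..<k})" by auto
  then have "card (crossing_pairs n) = card (SIGMA k:{..<n + 2}. {..<k}) - card ((\<lambda>a. (Suc a, a)) ` {..<n})"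
    unfolding crossing_pairs_def by (intro card_Diff_subset) auto
  moreover have "card (SIGMA k:{..<n + 2}. {..<k}) = (\<Sum>k<n + 2. k)" by simp
  moreover have "card ((\<lambda>a. (Suc a, a)) ` {..<n}) = n" by (simp add: card_image inj_on_def)
  ultimately show ?thesis using sum_lessThan_choose_2 by metis
qed

lemma crossing_pairsD: "(k, a) \<in> crossing_pairs n \<Longrightarrow> a < k \<and> k \<le> n + 1 \<and> \<not> adjacent n a k"
  by (auto simp: crossing_pairs_def adjacent_def)

text \<open>No three segments concur, so distinct crossing pairs give distinct points.\<close>

lemma example_num_points_ge: "((n + 2) choose 2) - n \<le> num_points (example n)"
proof -
  let ?g = "\<lambda>(k, a). cross_pt n a k"
  have "inj_on ?g (crossing_pairs n)"
  proof (rule inj_onI)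
    fix e f assume e: "e \<in> crossing_pairs n" and f: "f \<in> crossing_pairs n" and eq: "?g e = ?g f"
    obtain k a l b where kl: "e = (k, a)" "f = (l, b)" by (cases e, cases f)
    define p where "p = cross_pt n a k"
    have ka: "a < k" "k \<le> n + 1" "\<not> adjacent n a k" using crossing_pairsD e kl by blast+
    have lb: "b < l" "l \<le> n + 1" "\<not> adjacent n b l" using crossing_pairsD f kl by blast+
    have mem: "p \<in> ex_seg n a" "p \<in> ex_seg n k" using cross_pt_mem[OF ka] by (simp_all add: p_def)
    have "p = cross_pt n b l" using eq kl by (simp add: p_def)
    then have mem': "p \<in> ex_seg n b" "p \<in> ex_seg n l" using cross_pt_mem[OF lb] by simp_all
    have "k = l"
    proof (rule linorder_cases[of k l])
      assume "k < l" then show ?thesis using ex_seg_no_three[OF ka(1) _ lb(2) mem mem'(2)] by blast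
    next
      assume "l < k" then show ?thesis using ex_seg_no_three[OF lb(1) _ ka(2) mem' mem(2)] by blast
    qed
    moreover have "a = b"
    proof (rule linorder_cases[of a b])
      assume "a < b" then show ?thesis using ex_seg_no_three[OF _ lb(1,2) mem(1) mem'] by blast
    next
      assume "b < a" then show ?thesis using ex_seg_no_three[OF _ ka(1,2) mem'(1) mem] by blast
    qed
    ultimately show "e = f" using kl by simp
  qed
  moreover have "?g ` crossing_pairs n \<subseteq> crossing_points (example n)"
  proof (rule image_subsetI)
    fix e assume e: "e \<in> crossing_pairs n"
    obtain k a where ka: "e = (k, a)" by (cases e)
    then have *: "a < k" "k \<le> n + 1" "\<not> adjacent n a k" using crossing_pairsD e by blast+
    have "ex_seg n a \<noteq> ex_seg n k" using inj_on_eq_iff[OF ex_seg_inj[of n], of a k] * by simp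
    moreover have "ex_seg n a \<in> example n" "ex_seg n k \<in> example n" using * by (auto simp: example_def)
    ultimately show "?g e \<in> crossing_points (example n)"
      unfolding crossing_points_def ka prod.case using cross_pt_mem[OF *] by blast
  qed
  moreover have "finite (crossing_points (example n))"
    using finite_seg_verts[OF example_system] by (simp add: seg_verts_def)
  ultimately have "card (crossing_pairs n) \<le> num_points (example n)"
    unfolding num_points_def by (rule card_inj_on_le)
  then show ?thesis by (simp add: card_crossing_pairs)
qed

text \<open>The general bounds close the values from above. From below, points are counted directly
  and circuits follow by Euler's formula.\<close>

lemma example_tight:
  "int (num_points (example n)) = int ((n + 2) choose 2) - (int (n + 2) - 2)"
  "num_circuits (example n) = n choose 2"
proof -
  have ch: "(n + 2) choose 2 = (n choose 2) + 2 * n + 1" using choose_2_Suc_Suc[of n] by simp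
  have "int (num_points (example n)) \<le> int ((n + 2) choose 2) - int n"
    using K3_free_num_points[OF example_K3_free, of n] by (simp add: card_example)
  then have p: "num_points (example n) = (n choose 2) + n + 1"
    using example_num_points_ge[of n] unfolding ch by linarith
  then show "int (num_points (example n)) = int ((n + 2) choose 2) - (int (n + 2) - 2)"
    unfolding ch by simp
  have "example n \<noteq> {}" by (simp add: example_def)
  then have "n choose 2 \<le> num_circuits (example n)"
    using connected_num_circuits[OF example_system example_connected, of n] p by (simp add: card_example)
  moreover have "num_circuits (example n) \<le> n choose 2"
    using K3_free_num_circuits[OF example_K3_free, of n] by (simp add: card_example)
  ultimately show "num_circuits (example n) = n choose 2" by simp
qed

theorem theorem4:
  "(\<forall>M. segment_K3_free M \<longrightarrow>
      int (num_points M) \<le> int (card M choose 2) - (int (card M) - 2)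
      \<and> num_circuits M \<le> (card M - 2) choose 2)
   \<and> infinite {m. \<exists>M. segment_K3_free M \<and> card M = m
      \<and> int (num_points M) = int (m choose 2) - (int m - 2)
      \<and> num_circuits M = (m - 2) choose 2}"
proof (intro conjI allI impI)
  fix M assume "segment_K3_free M"
  then show "int (num_points M) \<le> int (card M choose 2) - (int (card M) - 2)"
    "num_circuits M \<le> (card M - 2) choose 2"
    using K3_free_num_points K3_free_num_circuits by blast+
next
  let ?S = "{m. \<exists>M. segment_K3_free M \<and> card M = m
      \<and> int (num_points M) = int (m choose 2) - (int m - 2)
      \<and> num_circuits M = (m - 2) choose 2}"
  have "range (\<lambda>n. n + 2) \<subseteq> ?S"
  proof (rule image_subsetI)
    fix n :: nat
    show "n + 2 \<in> ?S" unfolding mem_Collect_eq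
      using example_K3_free[of n] card_example[of n] example_tight[of n]
      by (intro exI[of _ "example n"]) simp
  qed
  moreover have "infinite (range (\<lambda>n :: nat. n + 2))" by (simp add: finite_image_iff inj_on_def)
  ultimately show "infinite ?S" using infinite_super by blast
qed

end
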